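(* Let $(X_n)_{n\in\mathbb{N}}$ be an $\mathcal{SL}$-submartingale with $\sup_k\mathcal{E}(|X_k|)<\infty$. Then the sequence $X_n$ converges quasi-surely to a random variable $X_\infty\in\mathcal{H}^{\mathrm{ext}}$ with $\mathcal{E}^{\mathrm{ext}}(|X_\infty|)<\infty$.
   Context: Let $(\Omega,\mathcal{F})$ be a measurable space with a discrete-time filtration $\{\mathcal{F}_t\}_{t\in\mathbb{N}}$, $\mathbb{N}=\{0,1,2,\dots\}$, such that $\mathcal{F}=\mathcal{F}_\infty=\sigma(\bigcup_t\mathcal{F}_t)$ and $\mathcal{F}_0$ is trivial. $m\mathcal{F}$, $m\mathcal{F}_t$ denote the $\mathcal{F}$-, $\mathcal{F}_t$-measurable $\mathbb{R}\cup\{\pm\infty\}$-valued functions. $\mathcal{H}$ is a linear space of $\mathcal{F}$-measurable $\mathbb{R}$-valued functions on $\Omega$ containing the constants, such that $X\in\mathcal{H}$ implies $|X|\in\mathcal{H}$ and $I_AX\in\mathcal{H}$ for all $A\in\mathcal{F}$; $\mathcal{H}_t:=\mathcal{H}\cap m\mathcal{F}_t$. $\mathcal{E}$ is an $\mathcal{SL}$-expectation: a family of maps $\mathcal{E}_t:\mathcal{H}\to\mathcal{H}_t$ such that for all $X,Y\in\mathcal{H}$, $s\le t$: (i) $X\ge Y$ implies $\mathcal{E}_t(X)\ge\mathcal{E}_t(Y)$; (ii) $\mathcal{E}_s(Y)=\mathcal{E}_s(\mathcal{E}_t(Y))$; (iii) $\mathcal{E}_t(I_AY)=I_A\mathcal{E}_t(Y)$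 for $A\in\mathcal{F}_t$; (iv) $\mathcal{E}_t(Y)=Y$ for $Y\in\mathcal{H}_t$; (v) $\mathcal{E}_t(X+Y)\le\mathcal{E}_t(X)+\mathcal{E}_t(Y)$; (vi) $\mathcal{E}_t(\lambda Y)=\lambda^+\mathcal{E}_t(Y)+\lambda^-\mathcal{E}_t(-Y)$ for $\lambda\in\mathcal{H}_t$ with $\lambda Y\in\mathcal{H}$; (vii) if $X_i\in\mathcal{H}$ and $X_i(\omega)\downarrow0$ for every $\omega$, then $\mathcal{E}_0(X_i)\to0$. Write $\mathcal{E}=\mathcal{E}_0$ (real-valued). Such $\mathcal{E}$ has a representation $\mathcal{E}(Y)=\sup_{\theta\in\Theta}E_\theta[Y]$ for a collection $\Theta$ of ($\sigma$-additive) probability measures, which is fixed. A statement holds quasi-surely (q.s.) if it holds outside a set $N$ with $\mathcal{E}(I_N)=0$. Define $\mathcal{H}^{\mathrm{ext}}=\{X\in m\mathcal{F}:\min\{E_\theta[X^+],E_\theta[X^-]\}<\infty\ \forall\theta\in\Theta\}$ and $\mathcal{E}^{\mathrm{ext}}(X)=\sup_{\theta\in\Theta}E_\theta[X]$. $L^1$ is the completion of $\{X\in\mathcal{H}:\mathcal{E}(|X|)<\infty\}$ under $\|X\|_1=\mathcal{E}(|X|)$, modulo equality in $\|\cdot\|_1$; its elements are regarded as elements of $\mathcal{H}^{\mathrm{ext}}$ (up to q.s. equality), and each $\mathcal{E}_t$ extends to $L^1$ by $\mathcal{E}_t(X)=\lim\mathcal{E}_t(X_n)$ (limit in $L^1$)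 for $X_n\to X$ in $L^1$. An $\mathcal{SL}$-submartingale is a process $X$ with $X_t\in L^1\cap m\mathcal{F}_t$ for all $t$ and $X_s\le\mathcal{E}_s(X_t)$ for all $s\le t$ (relations in $L^1$ are understood q.s.). *)

theory Defs
  imports "HOL-Probability.Probability"
begin

text \<open>
  The underlying set is \<^term>\<open>space M\<close>. A function on it is represented by a total function on the
  ambient type of which only the values on \<^term>\<open>space M\<close> matter; hence all relations between functions
  are restricted to \<^term>\<open>space M\<close>, and \<open>H_cong\<close> closes \<open>H\<close> under changes outside of it.
\<close>

locale sl_space = filtration "space M" F
  for M :: "'a measure" and F :: "nat \<Rightarrow> 'a measure" +
  fixes H :: "('a \<Rightarrow> real) set"
  assumes sets_M: "sets M = sigma_sets (space M) (\<Union>t. sets (F t))"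
    and F_0_trivial: "sets (F 0) = {{}, space M}"
    and H_measurable: "H \<subseteq> borel_measurable M"
    and H_cong: "X \<in> H \<Longrightarrow> (\<And>\<omega>. \<omega> \<in> space M \<Longrightarrow> Y \<omega> = X \<omega>) \<Longrightarrow> Y \<in> H"
    and H_add: "X \<in> H \<Longrightarrow> Y \<in> H \<Longrightarrow> (\<lambda>\<omega>. X \<omega> + Y \<omega>) \<in> H"
    and H_scale: "X \<in> H \<Longrightarrow> (\<lambda>\<omega>. c * X \<omega>) \<in> H"
    and H_const: "(\<lambda>\<omega>. c) \<in> H"
    and H_abs: "X \<in> H \<Longrightarrow> (\<lambda>\<omega>. \<bar>X \<omega>\<bar>) \<in> H"
    and H_indicator: "X \<in> H \<Longrightarrow> A \<in> sets M \<Longrightarrow> (\<lambda>\<omega>. indicator A \<omega> * X \<omega>) \<in> H"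
begin

definition H_at :: "nat \<Rightarrow> ('a \<Rightarrow> real) set" where
  "H_at t = H \<inter> borel_measurable (F t)"

end

text \<open>
  The value of a function that is constant on \<^term>\<open>space M\<close>. Since \<open>F 0\<close> is trivial, every
  \<open>F 0\<close>-measurable function is of this kind, and this turns the time-0 operator into a number.
\<close>

definition const_value :: "'a measure \<Rightarrow> ('a \<Rightarrow> 'b) \<Rightarrow> 'b" where
  "const_value M f = (THE c. \<forall>\<omega>\<in>space M. f \<omega> = c)"

locale sl_expectation = sl_space M F H
  for M :: "'a measure" and F :: "nat \<Rightarrow> 'a measure" and H :: "('a \<Rightarrow> real) set" +
  fixes E :: "nat \<Rightarrow> ('a \<Rightarrow> real) \<Rightarrow> 'a \<Rightarrow> real"
  assumes E_H: "X \<in> H \<Longrightarrow> E t X \<in> H_at t"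
    and E_mono: "X \<in> H \<Longrightarrow> Y \<in> H \<Longrightarrow> (\<And>\<omega>. \<omega> \<in> space M \<Longrightarrow> Y \<omega> \<le> X \<omega>) \<Longrightarrow>
      \<omega> \<in> space M \<Longrightarrow> E t Y \<omega> \<le> E t X \<omega>"
    and E_tower: "Y \<in> H \<Longrightarrow> s \<le> t \<Longrightarrow> \<omega> \<in> space M \<Longrightarrow> E s Y \<omega> = E s (E t Y) \<omega>"
    and E_indicator: "Y \<in> H \<Longrightarrow> A \<in> sets (F t) \<Longrightarrow> \<omega> \<in> space M \<Longrightarrow>
      E t (\<lambda>\<omega>'. indicator A \<omega>' * Y \<omega>') \<omega> = indicator A \<omega> * E t Y \<omega>"
    and E_adapted: "Y \<in> H_at t \<Longrightarrow> \<omega> \<in> space M \<Longrightarrow> E t Y \<omega> = Y \<omega>"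
    and E_subadditive: "X \<in> H \<Longrightarrow> Y \<in> H \<Longrightarrow> \<omega> \<in> space M \<Longrightarrow>
      E t (\<lambda>\<omega>'. X \<omega>' + Y \<omega>') \<omega> \<le> E t X \<omega> + E t Y \<omega>"
    and E_homogeneous: "Y \<in> H \<Longrightarrow> l \<in> H_at t \<Longrightarrow> (\<lambda>\<omega>'. l \<omega>' * Y \<omega>') \<in> H \<Longrightarrow> \<omega> \<in> space M \<Longrightarrow>
      E t (\<lambda>\<omega>'. l \<omega>' * Y \<omega>') \<omega>
        = max (l \<omega>) 0 * E t Y \<omega> + max (- l \<omega>) 0 * E t (\<lambda>\<omega>'. - Y \<omega>') \<omega>"
    and E_continuous: "(\<And>i. Z i \<in> H) \<Longrightarrow>
      (\<And>\<omega>. \<omega> \<in> space M \<Longrightarrow> decseq (\<lambda>i. Z i \<omega>) \<and> (\<lambda>i. Z i \<omega>) \<longlonglongrightarrow> 0) \<Longrightarrow>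
      (\<lambda>i. const_value M (E 0 (Z i))) \<longlonglongrightarrow> 0"
begin

definition expect :: "('a \<Rightarrow> real) \<Rightarrow> real" where
  "expect X = const_value M (E 0 X)"

definition quasi_surely :: "('a \<Rightarrow> bool) \<Rightarrow> bool" where
  "quasi_surely P \<longleftrightarrow> (\<exists>N\<in>sets M. expect (indicator N) = 0 \<and> (\<forall>\<omega>\<in>space M - N. P \<omega>))"

definition H_Cauchy :: "(nat \<Rightarrow> 'a \<Rightarrow> real) \<Rightarrow> bool" where
  "H_Cauchy Y \<longleftrightarrow> (\<forall>n. Y n \<in> H) \<and>
    (\<forall>e>0. \<exists>N. \<forall>m\<ge>N. \<forall>n\<ge>N. expect (\<lambda>\<omega>. \<bar>Y m \<omega> - Y n \<omega>\<bar>) < e)"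

end

text \<open>
  Integral of an extended real function under \<open>\<theta>\<close>, as \<open>E\<^sub>\<theta>[X\<^sup>+] - E\<^sub>\<theta>[X\<^sup>-]\<close>; \<^const>\<open>e2ennreal\<close> truncates
  negative values to 0. It is meaningful if one of the two parts is finite; in the library's
  convention \<open>\<infinity> - \<infinity> = \<infinity>\<close> otherwise.
\<close>

definition ext_integral :: "'a measure \<Rightarrow> ('a \<Rightarrow> ereal) \<Rightarrow> ereal" where
  "ext_integral \<theta> X = enn2ereal (\<integral>\<^sup>+\<omega>. e2ennreal (X \<omega>) \<partial>\<theta>) - enn2ereal (\<integral>\<^sup>+\<omega>. e2ennreal (- X \<omega>) \<partial>\<theta>)"

text \<open>
  For \<open>Y \<in> H\<close>, \<open>representation\<close> applied to \<open>\<bar>Y\<bar>\<close> shows that \<open>Y\<close> is integrable under every \<open>\<theta> \<in> \<Theta>\<close>, so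
  the integrals occurring in it are ordinary finite expectations.
\<close>

locale sl_representation = sl_expectation M F H E
  for M :: "'a measure" and F :: "nat \<Rightarrow> 'a measure" and H :: "('a \<Rightarrow> real) set"
    and E :: "nat \<Rightarrow> ('a \<Rightarrow> real) \<Rightarrow> 'a \<Rightarrow> real" +
  fixes \<Theta> :: "'a measure set"
  assumes Theta_prob: "\<theta> \<in> \<Theta> \<Longrightarrow> prob_space \<theta>"
    and Theta_sets: "\<theta> \<in> \<Theta> \<Longrightarrow> sets \<theta> = sets M"
    and representation: "Y \<in> H \<Longrightarrow>
      ereal (expect Y) = (SUP \<theta>\<in>\<Theta>. ext_integral \<theta> (\<lambda>\<omega>. ereal (Y \<omega>)))"
begin

definition H_ext :: "('a \<Rightarrow> ereal) set" where
  "H_ext = {X \<in> borel_measurable M. \<forall>\<theta>\<in>\<Theta>.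
    min (\<integral>\<^sup>+\<omega>. e2ennreal (X \<omega>) \<partial>\<theta>) (\<integral>\<^sup>+\<omega>. e2ennreal (- X \<omega>) \<partial>\<theta>) < \<infinity>}"

definition expect_ext :: "('a \<Rightarrow> ereal) \<Rightarrow> ereal" where
  "expect_ext X = (SUP \<theta>\<in>\<Theta>. ext_integral \<theta> X)"

definition tendsto_L1 :: "(nat \<Rightarrow> 'a \<Rightarrow> real) \<Rightarrow> ('a \<Rightarrow> ereal) \<Rightarrow> bool" where
  "tendsto_L1 Y X \<longleftrightarrow> (\<lambda>n. expect_ext (\<lambda>\<omega>. \<bar>ereal (Y n \<omega>) - X \<omega>\<bar>)) \<longlonglongrightarrow> 0"

text \<open>
  A point of the completion of \<open>H\<close> is a class of Cauchy sequences in \<open>H\<close> for the seminorm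
  \<open>expect \<bar>X\<bar>\<close>. The members of \<open>L1\<close> are the representatives in \<open>H_ext\<close> of these points: the function
  \<open>X\<close> stands for the class of \<open>Y\<close> iff \<open>Y\<close> tends to \<open>X\<close> for the seminorm \<open>expect_ext \<bar>X\<bar>\<close>, which
  agrees with \<open>expect \<bar>X\<bar>\<close> on \<open>H\<close>. Every class has such a representative (the limit of a rapidly
  converging subsequence), and two functions represent the same class iff they agree quasi-surely.
  Since \<open>expect\<close> is real-valued on \<open>H\<close>, the condition \<open>expect \<bar>X\<bar> < \<infinity>\<close> is automatic for \<open>X \<in> H\<close>.
\<close>

definition L1_approx :: "(nat \<Rightarrow> 'a \<Rightarrow> real) \<Rightarrow> ('a \<Rightarrow> ereal) \<Rightarrow> bool" where
  "L1_approx Y X \<longleftrightarrow> H_Cauchy Y \<and> tendsto_L1 Y X"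

definition L1 :: "('a \<Rightarrow> ereal) set" where
  "L1 = {X \<in> H_ext. \<exists>Y. L1_approx Y X}"

text \<open>
  The extension of \<open>E t\<close> to \<open>L1\<close> by \<open>L1\<close>-limits. The limit exists and does not depend on the
  approximating sequence, because \<open>\<bar>E t X - E t Y\<bar> \<le> E t \<bar>X - Y\<bar>\<close>; it is determined up to
  quasi-sure equality, and an \<open>F t\<close>-measurable version of it is chosen.
\<close>

definition E_L1 :: "nat \<Rightarrow> ('a \<Rightarrow> ereal) \<Rightarrow> 'a \<Rightarrow> ereal" where
  "E_L1 t X = (SOME Z. Z \<in> L1 \<inter> borel_measurable (F t) \<and>
    (\<forall>Y. L1_approx Y X \<longrightarrow> tendsto_L1 (\<lambda>n. E t (Y n)) Z))"

definition expect_L1 :: "('a \<Rightarrow> ereal) \<Rightarrow> ereal" where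
  "expect_L1 X = const_value M (E_L1 0 X)"

definition sl_submartingale :: "(nat \<Rightarrow> 'a \<Rightarrow> ereal) \<Rightarrow> bool" where
  "sl_submartingale X \<longleftrightarrow> (\<forall>t. X t \<in> L1 \<inter> borel_measurable (F t)) \<and>
    (\<forall>s t. s \<le> t \<longrightarrow> quasi_surely (\<lambda>\<omega>. X s \<omega> \<le> E_L1 s (X t) \<omega>))"

end

end

theory Submission
  imports Defs
begin

text \<open>
  The upcrossing argument only controls upcrossings from below: conditionally on \<open>F n\<close>, some measure
  makes \<open>X\<close> have few upcrossings after time \<open>n\<close>, i.e. \<open>1 - E\<^sub>n(I\<^sub>B)\<close> has small expectation for the event
  \<open>B\<close> of fewer than \<open>k\<close> upcrossings after \<open>n\<close>. This suffices because of continuity from above. The event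
  \<open>A\<close> of infinitely many upcrossings is approximated by some \<open>G\<close> in \<open>F n\<close>, and the bound gives
  \<open>E(I\<^sub>G) \<le> C / k + E(I\<^sub>G I\<^sub>B)\<close>, where \<open>A \<inter> B\<close> decreases to the empty set as the time horizon grows;
  hence \<open>E(I\<^sub>G) \<le> E(I\<^bsub>G - A\<^esub>)\<close>, which is small, and so \<open>E(I\<^sub>A) = 0\<close>.

  An \<open>L\<^sup>1\<close>-submartingale is first replaced by \<open>S\<close> with \<open>S\<^sub>t\<close> in \<open>H\<^sub>t\<close> and \<open>\<parallel>X\<^sub>t - S\<^sub>t\<parallel> \<le> 2\<^sup>-\<^sup>t\<close>. Then \<open>S\<close> is
  a submartingale up to summable errors, and \<open>X\<^sub>t - S\<^sub>t\<close> tends to 0 quasi-surely.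
\<close>

subsection \<open>Elementary properties of \<open>H\<close> and \<open>E\<close>\<close>

context sl_space
begin

lemma F_le_M: "A \<in> sets (F t) \<Longrightarrow> A \<in> sets M"
  using sets_M by (auto intro: sigma_sets.Basic)

lemma borel_F_le_M: "f \<in> borel_measurable (F t) \<Longrightarrow> f \<in> borel_measurable M"
  by (rule measurable_from_subalg[of M "F t"]) (auto simp: subalgebra_def space_F F_le_M)

lemma borel_F_mono: "s \<le> t \<Longrightarrow> f \<in> borel_measurable (F s) \<Longrightarrow> f \<in> borel_measurable (F t)"
  by (rule measurable_from_subalg[of "F t" "F s"])
    (use sets_F_mono[of s t] in \<open>auto simp: subalgebra_def space_F\<close>)

lemma H_atD: "X \<in> H_at t \<Longrightarrow> X \<in> H" "X \<in> H_at t \<Longrightarrow> X \<in> borel_measurable (F t)"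
  by (auto simp: H_at_def)

lemma H_at_mono: "s \<le> t \<Longrightarrow> X \<in> H_at s \<Longrightarrow> X \<in> H_at t"
  by (auto simp: H_at_def borel_F_mono)

lemma H_borel: "X \<in> H \<Longrightarrow> X \<in> borel_measurable M"
  using H_measurable by auto

lemma H_uminus: "X \<in> H \<Longrightarrow> (\<lambda>\<omega>. - X \<omega>) \<in> H"
  using H_scale[of X "-1"] by simp

lemma H_diff: "X \<in> H \<Longrightarrow> Y \<in> H \<Longrightarrow> (\<lambda>\<omega>. X \<omega> - Y \<omega>) \<in> H"
  using H_add[of X "\<lambda>\<omega>. - Y \<omega>"] H_uminus[of Y] by simp

lemma H_ind: "A \<in> sets M \<Longrightarrow> indicator A \<in> H"
  using H_indicator[OF H_const[of 1]] by simp

lemma H_mult_indicator: "X \<in> H \<Longrightarrow> A \<in> sets M \<Longrightarrow> (\<lambda>\<omega>. X \<omega> * indicator A \<omega>) \<in> H"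
  using H_indicator[of X A] by (simp add: mult.commute)

lemma H_max0: "X \<in> H \<Longrightarrow> (\<lambda>\<omega>. max 0 (X \<omega>)) \<in> H"
proof -
  assume X: "X \<in> H"
  have "(\<lambda>\<omega>. (1/2) * (X \<omega> + \<bar>X \<omega>\<bar>)) \<in> H"
    by (intro H_scale H_add X H_abs)
  then show ?thesis
    by (rule H_cong) (auto simp: max_def)
qed

lemma H_sum: "finite I \<Longrightarrow> (\<And>i. i \<in> I \<Longrightarrow> X i \<in> H) \<Longrightarrow> (\<lambda>\<omega>. \<Sum>i\<in>I. X i \<omega>) \<in> H"
  by (induction I rule: finite_induct) (auto intro: H_const H_add)

lemma H_at_const: "(\<lambda>\<omega>. c) \<in> H_at t"
  by (simp add: H_at_def H_const)

lemma H_at_add: "X \<in> H_at t \<Longrightarrow> Y \<in> H_at t \<Longrightarrow> (\<lambda>\<omega>. X \<omega> + Y \<omega>) \<in> H_at t"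
  by (auto simp: H_at_def H_add)

lemma H_at_scale: "X \<in> H_at t \<Longrightarrow> (\<lambda>\<omega>. c * X \<omega>) \<in> H_at t"
  by (auto simp: H_at_def H_scale)

lemma H_at_diff: "X \<in> H_at t \<Longrightarrow> Y \<in> H_at t \<Longrightarrow> (\<lambda>\<omega>. X \<omega> - Y \<omega>) \<in> H_at t"
  by (auto simp: H_at_def H_diff)

lemma H_at_max0: "X \<in> H_at t \<Longrightarrow> (\<lambda>\<omega>. max 0 (X \<omega>)) \<in> H_at t"
  by (auto simp: H_at_def H_max0)

lemma H_at_ind: "A \<in> sets (F t) \<Longrightarrow> indicator A \<in> H_at t"
  by (auto simp: H_at_def H_ind F_le_M)

lemma H_at_mult_indicator:
  "X \<in> H_at t \<Longrightarrow> A \<in> sets (F t) \<Longrightarrow> (\<lambda>\<omega>. X \<omega> * indicator A \<omega>) \<in> H_at t"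
  by (auto simp: H_at_def H_mult_indicator F_le_M)

text \<open>Singletons are closed in a \<open>t1_space\<close>, so the level set of \<open>f\<close>
  through \<open>\<omega>\<close> is a nonempty event of the trivial \<open>F 0\<close>, hence all
  of \<open>space M\<close>. The general codomain covers both the real-valued \<open>E 0 X\<close>
  and the \<open>ereal\<close>-valued \<open>E_L1 0 X\<close>.\<close>

lemma F_0_const:
  fixes f :: "'a \<Rightarrow> 'b::t1_space"
  assumes f: "f \<in> borel_measurable (F 0)" and w: "\<omega> \<in> space M"
  shows "const_value M f = f \<omega>"
proof -
  have "f -` {f \<omega>} \<inter> space (F 0) \<in> sets (F 0)"
    using f by (rule measurable_sets) simp
  then have "f -` {f \<omega>} \<inter> space M = space M"
    using F_0_trivial w by (auto simp: space_F)
  then have *: "f \<omega>' = f \<omega>" if "\<omega>' \<in> space M" for \<omega>'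
    using that by blast
  show ?thesis
    unfolding const_value_def by (rule the_equality) (use * w in fast)+
qed

end

section \<open>The operators \<open>E t\<close> and the number \<open>expect\<close>\<close>

context sl_representation
begin

lemma Theta_space: "\<theta> \<in> \<Theta> \<Longrightarrow> space \<theta> = space M"
  using Theta_sets by (metis sets_eq_imp_space_eq)

text \<open>An empty supremum would be minus infinity, whereas \<open>representation\<close> equates
  it with a real number.\<close>

lemma Theta_nonempty: "\<Theta> \<noteq> {}"
  using representation[OF H_const[of 0]] by (auto simp: bot_ereal_def)

lemma space_M_nonempty: "space M \<noteq> {}"
  using Theta_nonempty Theta_prob prob_space.not_empty Theta_space by blast

lemma expect_eq: "X \<in> H \<Longrightarrow> \<omega> \<in> space M \<Longrightarrow> expect X = E 0 X \<omega>"
  unfolding expect_def by (rule F_0_const) (use E_H H_atD in auto)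

lemma E_in_H: "X \<in> H \<Longrightarrow> E t X \<in> H"
  using E_H H_atD by blast

lemma E_cong:
  "X \<in> H \<Longrightarrow> Y \<in> H \<Longrightarrow> (\<And>\<omega>. \<omega> \<in> space M \<Longrightarrow> X \<omega> = Y \<omega>) \<Longrightarrow> \<omega> \<in> space M \<Longrightarrow> E t X \<omega> = E t Y \<omega>"
  by (intro antisym E_mono) auto

lemma expect_mono:
  "X \<in> H \<Longrightarrow> Y \<in> H \<Longrightarrow> (\<And>\<omega>. \<omega> \<in> space M \<Longrightarrow> X \<omega> \<le> Y \<omega>) \<Longrightarrow> expect X \<le> expect Y"
  using space_M_nonempty by (auto simp: expect_eq E_mono)

lemma expect_cong:
  "X \<in> H \<Longrightarrow> Y \<in> H \<Longrightarrow> (\<And>\<omega>. \<omega> \<in> space M \<Longrightarrow> X \<omega> = Y \<omega>) \<Longrightarrow> expect X = expect Y"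
  by (intro antisym expect_mono) auto

lemma expect_add_le: "X \<in> H \<Longrightarrow> Y \<in> H \<Longrightarrow> expect (\<lambda>\<omega>. X \<omega> + Y \<omega>) \<le> expect X + expect Y"
  using space_M_nonempty by (auto simp: expect_eq E_subadditive H_add)

lemma expect_const: "expect (\<lambda>\<omega>. c) = c"
  using space_M_nonempty by (auto simp: expect_eq H_const E_adapted[OF H_at_const])

lemma E_scale:
  assumes "X \<in> H" "0 \<le> c" "\<omega> \<in> space M"
  shows "E t (\<lambda>\<omega>. c * X \<omega>) \<omega> = c * E t X \<omega>"
  using E_homogeneous[OF assms(1) H_at_const H_scale[OF assms(1)] assms(3)] assms by simp

lemma expect_indicator_empty: "expect (indicator {}) = 0"
  using expect_cong[OF H_ind[of "{}"] H_const[of 0]] by (simp add: expect_const)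

lemma expect_scale: "X \<in> H \<Longrightarrow> 0 \<le> c \<Longrightarrow> expect (\<lambda>\<omega>. c * X \<omega>) = c * expect X"
  using space_M_nonempty by (auto simp: expect_eq E_scale H_scale)

lemma expect_nonneg: "X \<in> H \<Longrightarrow> (\<And>\<omega>. \<omega> \<in> space M \<Longrightarrow> 0 \<le> X \<omega>) \<Longrightarrow> 0 \<le> expect X"
  using expect_mono[OF H_const, of X 0] by (simp add: expect_const)

lemma expect_sum_le:
  "finite I \<Longrightarrow> (\<And>i. i \<in> I \<Longrightarrow> X i \<in> H) \<Longrightarrow> expect (\<lambda>\<omega>. \<Sum>i\<in>I. X i \<omega>) \<le> (\<Sum>i\<in>I. expect (X i))"
proof (induction I rule: finite_induct)
  case (insert i I)
  have "expect (\<lambda>\<omega>. X i \<omega> + (\<Sum>i\<in>I. X i \<omega>)) \<le> expect (X i) + expect (\<lambda>\<omega>. \<Sum>i\<in>I. X i \<omega>)"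
    by (intro expect_add_le H_sum) (use insert in auto)
  with insert show ?case by force
qed (simp add: expect_const)

lemma expect_E: "X \<in> H \<Longrightarrow> expect (E t X) = expect X"
  using space_M_nonempty by (auto simp: expect_eq E_in_H E_tower[of X 0 t, symmetric])

lemma expect_LIMSEQ_0:
  "(\<And>i. Z i \<in> H) \<Longrightarrow> (\<And>\<omega>. \<omega> \<in> space M \<Longrightarrow> decseq (\<lambda>i. Z i \<omega>)) \<Longrightarrow>
    (\<And>\<omega>. \<omega> \<in> space M \<Longrightarrow> (\<lambda>i. Z i \<omega>) \<longlonglongrightarrow> 0) \<Longrightarrow> (\<lambda>i. expect (Z i)) \<longlonglongrightarrow> 0"
  unfolding expect_def by (rule E_continuous) auto

text \<open>Every later use of continuity from above has this form: a fixed nonnegative weight in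
  \<open>H\<close> restricted to events shrinking to the empty set.\<close>

lemma expect_indicator_LIMSEQ_0:
  assumes X: "X \<in> H" "\<And>\<omega>. \<omega> \<in> space M \<Longrightarrow> 0 \<le> X \<omega>"
    and B: "\<And>i. B i \<in> sets M" "decseq B" "(\<Inter>i. B i) = {}"
  shows "(\<lambda>i. expect (\<lambda>\<omega>. X \<omega> * indicator (B i) \<omega>)) \<longlonglongrightarrow> 0"
proof (rule expect_LIMSEQ_0)
  fix \<omega> assume w: "\<omega> \<in> space M"
  show "decseq (\<lambda>i. X \<omega> * indicator (B i) \<omega>)"
    using B(2) X(2)[OF w] by (auto simp: decseq_def indicator_def)
  have "(\<lambda>i. indicator (B i) \<omega> :: real) \<longlonglongrightarrow> indicator (\<Inter>i. B i) \<omega>"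
    by (rule LIMSEQ_indicator_decseq[OF B(2)])
  then show "(\<lambda>i. X \<omega> * indicator (B i) \<omega>) \<longlonglongrightarrow> 0"
    using B(3) by (auto intro: tendsto_mult_right_zero)
qed (auto intro: H_mult_indicator X B)

text \<open>Subadditivity applied to \<open>X \<le> Y + \<bar>X - Y\<bar>\<close>, and
  symmetrically. With the tower property it makes \<open>E t\<close> a contraction for the
  seminorm.\<close>

lemma E_abs_diff_le:
  assumes "X \<in> H" "Y \<in> H" "\<omega> \<in> space M"
  shows "\<bar>E t X \<omega> - E t Y \<omega>\<bar> \<le> E t (\<lambda>\<omega>. \<bar>X \<omega> - Y \<omega>\<bar>) \<omega>"
proof -
  have *: "E t X \<omega> \<le> E t Y \<omega> + E t (\<lambda>\<omega>. \<bar>X \<omega> - Y \<omega>\<bar>) \<omega>" if "X \<in> H" "Y \<in> H" for X Y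
  proof -
    have "E t X \<omega> \<le> E t (\<lambda>\<omega>. Y \<omega> + \<bar>X \<omega> - Y \<omega>\<bar>) \<omega>"
      by (rule E_mono) (auto intro!: H_add H_abs H_diff assms that)
    also have "\<dots> \<le> E t Y \<omega> + E t (\<lambda>\<omega>. \<bar>X \<omega> - Y \<omega>\<bar>) \<omega>"
      by (rule E_subadditive) (auto intro!: H_abs H_diff assms that)
    finally show ?thesis .
  qed
  show ?thesis
    using *[OF assms(1,2)] *[OF assms(2,1)] by (simp add: abs_minus_commute)
qed

lemma expect_abs_E_diff_le:
  assumes "X \<in> H" "Y \<in> H"
  shows "expect (\<lambda>\<omega>. \<bar>E t X \<omega> - E t Y \<omega>\<bar>) \<le> expect (\<lambda>\<omega>. \<bar>X \<omega> - Y \<omega>\<bar>)"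
proof -
  have "expect (\<lambda>\<omega>. \<bar>E t X \<omega> - E t Y \<omega>\<bar>) \<le> expect (E t (\<lambda>\<omega>. \<bar>X \<omega> - Y \<omega>\<bar>))"
    by (intro expect_mono E_abs_diff_le H_abs H_diff E_in_H assms)
  also have "\<dots> = expect (\<lambda>\<omega>. \<bar>X \<omega> - Y \<omega>\<bar>)"
    by (intro expect_E H_abs H_diff assms)
  finally show ?thesis .
qed

text \<open>Locality: the indicator of an event of \<open>F t\<close> passes through
  \<open>E t\<close>, so a comparison on \<open>A\<close> becomes a global one after multiplication
  by it. The upcrossing step can thus be treated separately on each phase.\<close>

lemma E_mono_on:
  assumes XY: "X \<in> H" "Y \<in> H" and A: "A \<in> sets (F t)"
    and le: "\<And>\<omega>. \<omega> \<in> A \<Longrightarrow> X \<omega> \<le> Y \<omega>" and w: "\<omega> \<in> A"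
  shows "E t X \<omega> \<le> E t Y \<omega>"
proof -
  have wM: "\<omega> \<in> space M"
    using A w sets.sets_into_space[OF A] by (auto simp: space_F)
  have "E t (\<lambda>\<omega>. indicator A \<omega> * X \<omega>) \<omega> \<le> E t (\<lambda>\<omega>. indicator A \<omega> * Y \<omega>) \<omega>"
    by (rule E_mono) (auto intro!: H_indicator F_le_M[OF A] XY wM le split: split_indicator)
  then show ?thesis
    using w by (simp add: E_indicator[OF _ A wM] XY)
qed

text \<open>Subadditivity for \<open>X = (X - Y) + Y\<close>, where \<open>E t\<close> fixes
  \<open>Y\<close>.\<close>

lemma E_diff_ge:
  assumes "X \<in> H" "Y \<in> H_at t" "\<omega> \<in> space M"
  shows "E t X \<omega> - Y \<omega> \<le> E t (\<lambda>\<omega>. X \<omega> - Y \<omega>) \<omega>"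
proof -
  have "E t X \<omega> = E t (\<lambda>\<omega>. (X \<omega> - Y \<omega>) + Y \<omega>) \<omega>"
    by (rule E_cong) (auto intro!: H_add H_diff assms H_atD[OF assms(2)])
  also have "\<dots> \<le> E t (\<lambda>\<omega>. X \<omega> - Y \<omega>) \<omega> + E t Y \<omega>"
    by (rule E_subadditive) (auto intro!: H_add H_diff assms H_atD[OF assms(2)])
  finally show ?thesis
    using E_adapted[OF assms(2,3)] by simp
qed

lemma E_nonneg: "X \<in> H \<Longrightarrow> (\<And>\<omega>. \<omega> \<in> space M \<Longrightarrow> 0 \<le> X \<omega>) \<Longrightarrow> \<omega> \<in> space M \<Longrightarrow> 0 \<le> E t X \<omega>"
  using E_mono[of X "\<lambda>_. 0" \<omega> t] E_adapted[OF H_at_const, of \<omega> t 0] by (simp add: H_const)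

end

subsection \<open>Approximation of events\<close>

context sl_representation
begin

text \<open>Induction over the generation of the sigma-algebra. Complements leave the symmetric
  difference unchanged; a countable union is cut to a finite one, and continuity from above makes
  the lost tail small uniformly over \<Theta>.\<close>

lemma approx_by_F:
  assumes "A \<in> sets M" "0 < e"
  shows "\<exists>n. \<exists>G\<in>sets (F n). expect (indicator (sym_diff A G)) < e"
proof -
  have "A \<in> sigma_sets (space M) (\<Union>t. sets (F t))"
    using assms sets_M by simp
  then show ?thesis
    using \<open>0 < e\<close>
  proof (induction arbitrary: e)
    case (Basic A)
    then obtain t where "A \<in> sets (F t)" by blast
    moreover have "expect (indicator (sym_diff A A)) < e"
      using Basic by (simp only: Diff_cancel Un_absorb expect_indicator_empty)
    ultimately show ?case by blast
  next
    case Empty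
    have "expect (indicator (sym_diff {} {})) < e"
      using Empty by (simp only: Diff_cancel Un_absorb expect_indicator_empty)
    then show ?case by blast
  next
    case (Compl A)
    obtain n G where G: "G \<in> sets (F n)" "expect (indicator (sym_diff A G)) < e"
      using Compl by blast
    have A: "A \<in> sets M"
      using Compl sets_M by simp
    have "sym_diff (space M - A) (space M - G) = sym_diff A G"
      using sets.sets_into_space[OF A] sets.sets_into_space[OF F_le_M[OF G(1)]] by blast
    moreover have "space M - G \<in> sets (F n)"
      using G(1) space_F by (metis sets.compl_sets)
    ultimately show ?case
      using G(2) by metis
  next
    case (Union A)
    have A: "A i \<in> sets M" for i
      using Union sets_M by simp
    define B where "B m = (\<Union>i. A i) - (\<Union>i<m. A i)" for m :: nat
    have B: "B m \<in> sets M" for m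
      unfolding B_def using A by auto
    have "(\<lambda>m. expect (\<lambda>\<omega>. 1 * indicator (B m) \<omega>)) \<longlonglongrightarrow> 0"
      by (rule expect_indicator_LIMSEQ_0) (auto intro!: H_const B, auto simp: B_def decseq_def)
    then have "(\<lambda>m. expect (indicator (B m))) \<longlonglongrightarrow> 0"
      by simp
    then have "eventually (\<lambda>m. expect (indicator (B m)) < e / 2) sequentially"
      by (rule order_tendstoD) (use Union in auto)
    then obtain m where m: "expect (indicator (B m)) < e / 2"
      by (auto simp: eventually_sequentially)
    \<comment> \<open>The tolerance makes the \<open>m\<close> errors add up to at most
      \<open>e / 2\<close>; the added 1 keeps the denominator positive for
      \<open>m = 0\<close>.\<close>
    have "\<exists>n. \<exists>G\<in>sets (F n). expect (indicator (sym_diff (A i) G)) < e / (2 * (real m + 1))" for i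
      by (rule Union.IH) (use \<open>0 < e\<close> in \<open>simp add: divide_simps\<close>)
    then obtain k G where G: "\<And>i. G i \<in> sets (F (k i))"
      "\<And>i. expect (indicator (sym_diff (A i) (G i))) < e / (2 * (real m + 1))"
      by metis
    \<comment> \<open>A common time for the finitely many approximants; the inserted 0 covers
      \<open>m = 0\<close>.\<close>
    define n where "n = Max (insert 0 (k ` {..<m}))"
    have Gn: "G i \<in> sets (F n)" if "i < m" for i
    proof -
      have "k i \<le> n"
        unfolding n_def using that by (intro Max_ge) auto
      then show ?thesis
        using G(1)[of i] sets_F_mono by blast
    qed
    define G' where "G' = (\<Union>i<m. G i)"
    have G': "G' \<in> sets (F n)"
      unfolding G'_def using Gn by auto
    note GM = F_le_M[OF G(1)]
    have "expect (indicator (sym_diff (\<Union>i. A i) G'))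
        \<le> expect (\<lambda>\<omega>. indicator (B m) \<omega> + (\<Sum>i<m. indicator (sym_diff (A i) (G i)) \<omega>))"
    proof (rule expect_mono)
      fix \<omega>
      have nn: "0 \<le> (\<Sum>i<m. indicator (sym_diff (A i) (G i)) \<omega> :: real)"
        by (intro sum_nonneg) auto
      show "indicator (sym_diff (\<Union>i. A i) G') \<omega>
        \<le> indicator (B m) \<omega> + (\<Sum>i<m. indicator (sym_diff (A i) (G i)) \<omega> :: real)"
      proof (cases "\<omega> \<in> sym_diff (\<Union>i. A i) G' \<and> \<omega> \<notin> B m")
        case True
        then obtain i where "i < m" "\<omega> \<in> sym_diff (A i) (G i)"
          by (auto simp: B_def G'_def)
        then have "1 \<le> (\<Sum>i<m. indicator (sym_diff (A i) (G i)) \<omega> :: real)"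
          using member_le_sum[of i "{..<m}" "\<lambda>i. indicator (sym_diff (A i) (G i)) \<omega> :: real"] by simp
        then show ?thesis
          using True by simp
      next
        case False
        then show ?thesis
          using nn by (auto split: split_indicator)
      qed
    qed (use A B GM F_le_M[OF G'] in \<open>auto intro!: H_ind H_add H_sum\<close>)
    also have "\<dots> \<le> expect (indicator (B m)) + (\<Sum>i<m. expect (indicator (sym_diff (A i) (G i))))"
      by (intro order.trans[OF expect_add_le] add_mono expect_sum_le)
        (use A B GM in \<open>auto intro!: H_ind H_sum\<close>)
    also have "\<dots> \<le> expect (indicator (B m)) + (\<Sum>i<m. e / (2 * (real m + 1)))"
      by (intro add_mono sum_mono) (use G(2) in \<open>auto intro: less_imp_le\<close>)
    also have "(\<Sum>i<m. e / (2 * (real m + 1))) \<le> e / 2"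
      using \<open>0 < e\<close> by (simp add: divide_simps)
    finally have "expect (indicator (sym_diff (\<Union>i. A i) G')) < e"
      using m by simp
    with G' show ?case by blast
  qed
qed

subsection \<open>Upcrossings\<close>

text \<open>
  Paths in \<open>phase V c n j\<close> at time \<open>n + j\<close> are waiting for \<open>V\<close> to reach 0, the others for \<open>V\<close> to reach
  \<open>c\<close>; \<open>upcross\<close> collects the paths that complete an upcrossing of \<open>[0, c]\<close> at time \<open>n + j + 1\<close>.
\<close>

primrec phase :: "(nat \<Rightarrow> 'a \<Rightarrow> real) \<Rightarrow> real \<Rightarrow> nat \<Rightarrow> nat \<Rightarrow> 'a set" where
  "phase V c n 0 = space M"
| "phase V c n (Suc j) = {\<omega>\<in>space M. (\<omega> \<in> phase V c n j \<and> 0 < V (Suc (n + j)) \<omega>) \<or>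
      (\<omega> \<notin> phase V c n j \<and> c \<le> V (Suc (n + j)) \<omega>)}"

definition upcross :: "(nat \<Rightarrow> 'a \<Rightarrow> real) \<Rightarrow> real \<Rightarrow> nat \<Rightarrow> nat \<Rightarrow> 'a set" where
  "upcross V c n j = {\<omega>\<in>space M. \<omega> \<notin> phase V c n j \<and> c \<le> V (Suc (n + j)) \<omega>}"

text \<open>The upcrossings completed at times \<open>n + 1\<close> up to \<open>n + j\<close>. The
  count is real-valued so that it can be an element of \<open>H\<close>.\<close>

definition ups :: "(nat \<Rightarrow> 'a \<Rightarrow> real) \<Rightarrow> real \<Rightarrow> nat \<Rightarrow> nat \<Rightarrow> 'a \<Rightarrow> real" where
  "ups V c n j \<omega> = (\<Sum>i<j. indicator (upcross V c n i) \<omega>)"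

lemma ups_Suc: "ups V c n (Suc j) \<omega> = ups V c n j \<omega> + indicator (upcross V c n j) \<omega>"
  by (simp add: ups_def)

lemma phase_sets:
  assumes "\<And>t. V t \<in> H_at t"
  shows "phase V c n j \<in> sets (F (n + j))"
proof (induction j)
  case 0
  show ?case using sets.top[of "F n"] by (simp add: space_F)
next
  case (Suc j)
  have [measurable]: "V (Suc (n + j)) \<in> borel_measurable (F (Suc (n + j)))"
    using assms H_atD by blast
  have [measurable]: "phase V c n j \<in> sets (F (Suc (n + j)))"
    using Suc sets_F_mono[of "n + j" "Suc (n + j)"] by auto
  have "{\<omega>\<in>space (F (Suc (n + j))). (\<omega> \<in> phase V c n j \<and> 0 < V (Suc (n + j)) \<omega>) \<or>
      (\<omega> \<notin> phase V c n j \<and> c \<le> V (Suc (n + j)) \<omega>)} \<in> sets (F (Suc (n + j)))"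
    by measurable
  then show ?case by (simp add: space_F)
qed

lemma upcross_sets:
  assumes "\<And>t. V t \<in> H_at t"
  shows "upcross V c n j \<in> sets (F (Suc (n + j)))"
proof -
  have [measurable]: "V (Suc (n + j)) \<in> borel_measurable (F (Suc (n + j)))"
    using assms H_atD by blast
  have [measurable]: "phase V c n j \<in> sets (F (Suc (n + j)))"
    using phase_sets[OF assms, of c n j] sets_F_mono[of "n + j" "Suc (n + j)"] by auto
  have "{\<omega>\<in>space (F (Suc (n + j))). \<omega> \<notin> phase V c n j \<and> c \<le> V (Suc (n + j)) \<omega>}
      \<in> sets (F (Suc (n + j)))"
    by measurable
  then show ?thesis by (simp add: space_F upcross_def)
qed

lemma ups_H:
  assumes "\<And>t. V t \<in> H_at t"
  shows "ups V c n j \<in> H_at (n + j)"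
proof (induction j)
  case 0
  show ?case using H_at_const[of 0] by (simp add: ups_def[abs_def])
next
  case (Suc j)
  have "(\<lambda>\<omega>. ups V c n j \<omega> + indicator (upcross V c n j) \<omega>) \<in> H_at (n + Suc j)"
    by (rule H_at_add) (use H_at_mono[OF _ Suc, of "n + Suc j"] H_at_ind[OF upcross_sets[OF assms]] in auto)
  then show ?case by (simp add: ups_Suc[abs_def])
qed

lemma ups_mono: "i \<le> j \<Longrightarrow> ups V c n i \<omega> \<le> ups V c n j \<omega>"
  unfolding ups_def by (intro sum_mono2) auto

text \<open>After any step the path still visits the lower level and then the upper one, which
  completes a further upcrossing; induction on \<open>k\<close> collects them.\<close>

lemma ups_unbounded:
  assumes c: "0 < c" and w: "\<omega> \<in> space M"
    and low: "\<And>m. \<exists>t\<ge>m. V t \<omega> \<le> 0" and high: "\<And>m. \<exists>t\<ge>m. c \<le> V t \<omega>"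
  shows "\<exists>j. real k \<le> ups V c n j \<omega>"
proof (induction k)
  case 0
  show ?case by (auto simp: ups_def intro: exI[of _ 0])
next
  case (Suc k)
  then obtain j where j: "real k \<le> ups V c n j \<omega>" by blast
  have "\<exists>i\<ge>j. \<omega> \<in> upcross V c n i"
  proof (rule ccontr)
    assume no: "\<not> (\<exists>i\<ge>j. \<omega> \<in> upcross V c n i)"
    obtain t where t: "t \<ge> Suc (n + j)" "V t \<omega> \<le> 0"
      using low by blast
    define i where "i = t - Suc n"
    have i: "t = Suc (n + i)" "j \<le> i"
      using t by (auto simp: i_def)
    \<comment> \<open>Once at the lower level the path waits for \<open>c\<close>, and only an
      upcrossing can end this wait.\<close>
    have out: "\<omega> \<notin> phase V c n (Suc i + l)" for l
    proof (induction l)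
      case 0
      show ?case using t(2) c i by auto
    next
      case (Suc l)
      have "\<omega> \<notin> upcross V c n (Suc i + l)"
        using no i by auto
      with Suc w show ?case by (auto simp: upcross_def)
    qed
    obtain u where u: "u \<ge> Suc t" "c \<le> V u \<omega>"
      using high by blast
    define l where "l = u - Suc t"
    have "u = Suc (n + (Suc i + l))"
      using u i by (auto simp: l_def)
    then have "\<omega> \<in> upcross V c n (Suc i + l)"
      using out[of l] u w by (simp add: upcross_def)
    then show False
      using no i by auto
  qed
  then obtain i where i: "i \<ge> j" "\<omega> \<in> upcross V c n i" by blast
  have "real (Suc k) \<le> ups V c n (Suc i) \<omega>"
    using ups_mono[OF i(1), of V c n \<omega>] j i(2) by (simp add: ups_Suc)
  then show ?case by blast
qed

text \<open>
  \<open>\<Psi>\<close> collects the increments of \<open>V\<close> outside of its upcrossings. Only these can be used: the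
  \<open>E\<close>-submartingale property is preserved by nonnegative predictable weights, but the complementary
  increments cannot be estimated, since \<open>E\<close> is only subadditive.
\<close>

lemma upcrossing_step:
  fixes V z :: "nat \<Rightarrow> 'a \<Rightarrow> real" and n :: nat
  assumes V: "\<And>t. V t \<in> H_at t" and V0: "\<And>t \<omega>. 0 \<le> V t \<omega>"
    and z: "\<And>t. z t \<in> H_at t" "\<And>t \<omega>. 0 \<le> z t \<omega>"
    and sub: "\<And>t \<omega>. \<omega> \<in> space M \<Longrightarrow> V t \<omega> \<le> E t (V (Suc t)) \<omega> + z t \<omega>"
    and c: "0 < c" and w: "\<omega> \<in> space M"
  defines "\<Psi> \<equiv> \<lambda>j \<omega>. V (n + j) \<omega> * indicator (phase V c n j) \<omega> - c * ups V c n j \<omega>"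
  shows "\<Psi> j \<omega> \<le> E (n + j) (\<Psi> (Suc j)) \<omega> + z (n + j) \<omega>"
proof -
  have \<Psi>_at: "\<Psi> j \<in> H_at (n + j)" for j
    unfolding \<Psi>_def by (intro H_at_diff H_at_mult_indicator H_at_scale V phase_sets ups_H)
  note VH = H_atD(1)[OF V]
  note UH = ups_H[OF V, of c n j]
  note P = phase_sets[OF V, of c n j]
  have PM: "phase V c n j \<subseteq> space M"
    using P sets.sets_into_space space_F by blast
  show ?thesis
  proof (cases "\<omega> \<in> phase V c n j")
    case True
    have "V (n + j) \<omega> - c * ups V c n j \<omega>
        \<le> E (n + j) (V (Suc (n + j))) \<omega> - c * ups V c n j \<omega> + z (n + j) \<omega>"
      using sub[OF w] by simp
    also have "E (n + j) (V (Suc (n + j))) \<omega> - c * ups V c n j \<omega>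
        \<le> E (n + j) (\<lambda>\<omega>. V (Suc (n + j)) \<omega> - c * ups V c n j \<omega>) \<omega>"
      by (intro E_diff_ge VH H_at_scale UH w)
    also have "\<dots> \<le> E (n + j) (\<Psi> (Suc j)) \<omega>"
    proof (rule E_mono_on[OF _ _ P _ True])
      \<comment> \<open>No upcrossing is completed from this phase. A path leaves it only with
        \<open>V\<close> equal to 0, by nonnegativity, so the value of \<open>V\<close> dropped from
        \<Psi> is 0.\<close>
      fix \<omega>' assume w': "\<omega>' \<in> phase V c n j"
      then show "V (Suc (n + j)) \<omega>' - c * ups V c n j \<omega>' \<le> \<Psi> (Suc j) \<omega>'"
        using PM V0[of "Suc (n + j)" \<omega>']
        by (auto simp: \<Psi>_def ups_Suc upcross_def split: split_indicator)
    qed (auto intro!: H_diff VH H_scale H_atD(1)[OF UH] H_atD(1)[OF \<Psi>_at])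
    finally show ?thesis
      using True by (simp add: \<Psi>_def)
  next
    case False
    have "- c * ups V c n j \<omega> = E (n + j) (\<lambda>\<omega>. - c * ups V c n j \<omega>) \<omega>"
      by (intro E_adapted[symmetric] H_at_scale UH w)
    also have "\<dots> \<le> E (n + j) (\<Psi> (Suc j)) \<omega>"
    proof (rule E_mono_on)
      show "space M - phase V c n j \<in> sets (F (n + j))"
        using sets.compl_sets[OF P] by (simp add: space_F)
      \<comment> \<open>A completed upcrossing brings back a value of \<open>V\<close> of at least
        \<open>c\<close>, which pays for the \<open>c\<close> charged by the count; otherwise \<Psi>
        stays the same.\<close>
      fix \<omega>' assume "\<omega>' \<in> space M - phase V c n j"
      then show "- c * ups V c n j \<omega>' \<le> \<Psi> (Suc j) \<omega>'"
        using c by (auto simp: \<Psi>_def ups_Suc upcross_def algebra_simps split: split_indicator)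
    qed (use w False in \<open>auto intro!: H_uminus H_scale H_atD(1)[OF UH] H_atD(1)[OF \<Psi>_at]\<close>)
    finally show ?thesis
      using False z(2)[of "n + j" \<omega>] by (simp add: \<Psi>_def)
  qed
qed

text \<open>Iterating the step from \<Psi> at time \<open>n\<close>, which is nonnegative, bounds
  \<open>c * k * (1 - E n (indicator B))\<close> by the terminal value and the errors. On
  \<open>G\<close> the constant 1 splits into this deficit and \<open>E n (indicator B)\<close>, and
  the latter turns into \<open>G \<inter> B\<close> by locality and the tower property.\<close>

lemma upcrossing_bound:
  fixes V z :: "nat \<Rightarrow> 'a \<Rightarrow> real" and n j :: nat and k :: real
  assumes V: "\<And>t. V t \<in> H_at t" and V0: "\<And>t \<omega>. 0 \<le> V t \<omega>"
    and z: "\<And>t. z t \<in> H_at t" "\<And>t \<omega>. 0 \<le> z t \<omega>"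
    and sub: "\<And>t \<omega>. \<omega> \<in> space M \<Longrightarrow> V t \<omega> \<le> E t (V (Suc t)) \<omega> + z t \<omega>"
    and c: "0 < c" and k: "0 < k" and G: "G \<in> sets (F n)"
  defines "B \<equiv> {\<omega>\<in>space M. ups V c n j \<omega> < k}"
  shows "expect (indicator G)
    \<le> (expect (V (n + j)) + (\<Sum>i<j. expect (z (n + i)))) / (c * k) + expect (indicator (G \<inter> B))"
proof -
  define \<Psi> where "\<Psi> j \<omega> = V (n + j) \<omega> * indicator (phase V c n j) \<omega> - c * ups V c n j \<omega>" for j \<omega>
  have \<Psi>_at: "\<Psi> j \<in> H_at (n + j)" for j
    unfolding \<Psi>_def[abs_def] by (intro H_at_diff H_at_mult_indicator H_at_scale V phase_sets ups_H)
  note \<Psi>H = H_atD(1)[OF \<Psi>_at] and VH = H_atD(1)[OF V] and zH = H_atD(1)[OF z(1)]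
  note UH = ups_H[OF V, of c n]
  have step: "\<Psi> j \<omega> \<le> E (n + j) (\<Psi> (Suc j)) \<omega> + z (n + j) \<omega>" if "\<omega> \<in> space M" for j \<omega>
    using upcrossing_step[of V z c \<omega> n j, OF V V0 z sub c that] by (simp add: \<Psi>_def[abs_def])
  have BM: "B \<in> sets M"
  proof -
    have [measurable]: "ups V c n j \<in> borel_measurable M"
      by (intro H_borel H_atD(1)[OF UH])
    show ?thesis unfolding B_def by measurable
  qed
  note IBH = H_ind[OF BM]
  have iter: "\<Psi> 0 \<omega> \<le> E n (\<Psi> j) \<omega> + (\<Sum>i<j. E n (z (n + i)) \<omega>)" if w: "\<omega> \<in> space M" for j \<omega>
  proof (induction j)
    case 0
    show ?case using E_adapted[of "\<Psi> 0" n \<omega>] \<Psi>_at[of 0] w by simp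
  next
    case (Suc j)
    have "E n (\<Psi> j) \<omega> \<le> E n (\<lambda>\<omega>. E (n + j) (\<Psi> (Suc j)) \<omega> + z (n + j) \<omega>) \<omega>"
      by (rule E_mono) (use step w in \<open>auto intro!: H_add E_in_H \<Psi>H zH\<close>)
    also have "\<dots> \<le> E n (E (n + j) (\<Psi> (Suc j))) \<omega> + E n (z (n + j)) \<omega>"
      by (intro E_subadditive E_in_H \<Psi>H zH w)
    also have "E n (E (n + j) (\<Psi> (Suc j))) \<omega> = E n (\<Psi> (Suc j)) \<omega>"
      by (intro E_tower[symmetric] \<Psi>H w) simp
    finally show ?case using Suc by simp
  qed
  \<comment> \<open>The conditional lower probability of at least \<open>k\<close> upcrossings by
    time \<open>n + j\<close>.\<close>
  define f where "f \<omega> = 1 - E n (indicator B) \<omega>" for \<omega>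
  have fH: "f \<in> H"
    unfolding f_def[abs_def] by (intro H_diff H_const E_in_H IBH)
  have f0: "0 \<le> f \<omega>" if w: "\<omega> \<in> space M" for \<omega>
    using E_mono[OF H_const[of 1] IBH _ w, of n] E_adapted[OF H_at_const[of 1] w, of n]
    by (simp add: f_def)
  have bound: "c * k * f \<omega> \<le> E n (V (n + j)) \<omega> + (\<Sum>i<j. E n (z (n + i)) \<omega>)"
    if w: "\<omega> \<in> space M" for \<omega>
  proof -
    have "0 \<le> \<Psi> 0 \<omega>"
      using w V0[of n \<omega>] by (simp add: \<Psi>_def ups_def)
    also note iter[OF w, of j]
    \<comment> \<open>Off \<open>B\<close> the count is at least \<open>k\<close>, on
      \<open>B\<close> it is at least 0, and restricting the nonnegative \<open>V\<close> to the
      phase only decreases it.\<close>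
    also have "E n (\<Psi> j) \<omega> \<le> E n (\<lambda>\<omega>. V (n + j) \<omega> + (c * k * indicator B \<omega> + - (c * k))) \<omega>"
    proof (rule E_mono)
      fix \<omega> assume w: "\<omega> \<in> space M"
      have "0 \<le> ups V c n j \<omega>"
        by (auto simp: ups_def intro!: sum_nonneg)
      then have "c * k * (1 - indicator B \<omega>) \<le> c * ups V c n j \<omega>"
        using w c by (auto simp: B_def indicator_def)
      moreover have "V (n + j) \<omega> * indicator (phase V c n j) \<omega> \<le> V (n + j) \<omega>"
        using V0[of "n + j" \<omega>] by (simp add: indicator_def)
      ultimately show "\<Psi> j \<omega> \<le> V (n + j) \<omega> + (c * k * indicator B \<omega> + - (c * k))"
        by (simp add: \<Psi>_def algebra_simps)
    qed (intro \<Psi>H H_add VH H_scale IBH H_const w)+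
    also have "\<dots> \<le> E n (V (n + j)) \<omega> + E n (\<lambda>\<omega>. c * k * indicator B \<omega> + - (c * k)) \<omega>"
      by (intro E_subadditive VH H_add H_scale IBH H_const w)
    also have "E n (\<lambda>\<omega>. c * k * indicator B \<omega> + - (c * k)) \<omega>
        \<le> E n (\<lambda>\<omega>. c * k * indicator B \<omega>) \<omega> + E n (\<lambda>\<omega>. - (c * k)) \<omega>"
      by (intro E_subadditive H_scale IBH H_const w)
    also have "\<dots> = c * k * E n (indicator B) \<omega> - c * k"
      using E_scale[OF IBH _ w, of "c * k" n] E_adapted[OF H_at_const w, of n "- (c * k)"] c k by simp
    finally show ?thesis
      by (simp add: f_def algebra_simps)
  qed
  have "c * k * expect f = expect (\<lambda>\<omega>. c * k * f \<omega>)"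
    using c k by (intro expect_scale[symmetric] fH) auto
  also have "\<dots> \<le> expect (\<lambda>\<omega>. E n (V (n + j)) \<omega> + (\<Sum>i<j. E n (z (n + i)) \<omega>))"
    by (intro expect_mono H_scale fH H_add H_sum E_in_H VH zH bound) auto
  also have "\<dots> \<le> expect (E n (V (n + j))) + (\<Sum>i<j. expect (E n (z (n + i))))"
    by (intro order.trans[OF expect_add_le] add_left_mono expect_sum_le H_sum E_in_H VH zH) auto
  also have "\<dots> = expect (V (n + j)) + (\<Sum>i<j. expect (z (n + i)))"
    by (simp add: expect_E VH zH)
  finally have ef: "expect f \<le> (expect (V (n + j)) + (\<Sum>i<j. expect (z (n + i)))) / (c * k)"
    using c k by (simp add: field_simps)
  note GM = F_le_M[OF G]
  have "expect (indicator G) \<le> expect (\<lambda>\<omega>. f \<omega> + indicator G \<omega> * E n (indicator B) \<omega>)"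
  proof (rule expect_mono)
    fix \<omega> assume "\<omega> \<in> space M"
    then show "indicator G \<omega> \<le> f \<omega> + indicator G \<omega> * E n (indicator B) \<omega>"
      using f0[of \<omega>] by (auto simp: f_def split: split_indicator)
  qed (intro H_ind GM H_add fH H_indicator E_in_H IBH)+
  also have "\<dots> \<le> expect f + expect (\<lambda>\<omega>. indicator G \<omega> * E n (indicator B) \<omega>)"
    by (intro expect_add_le fH H_indicator E_in_H IBH GM)
  also have "expect (\<lambda>\<omega>. indicator G \<omega> * E n (indicator B) \<omega>)
      = expect (E n (\<lambda>\<omega>. indicator G \<omega> * indicator B \<omega>))"
    by (intro expect_cong E_indicator[symmetric] H_indicator E_in_H IBH GM G)
  also have "\<dots> = expect (\<lambda>\<omega>. indicator G \<omega> * indicator B \<omega>)"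
    by (intro expect_E H_indicator IBH GM)
  also have "(\<lambda>\<omega>. indicator G \<omega> * indicator B \<omega>) = (indicator (G \<inter> B) :: 'a \<Rightarrow> real)"
    by (auto simp: indicator_def)
  finally show ?thesis
    using ef by simp
qed

section \<open>Oscillation events have upper probability 0\<close>

definition osc :: "(nat \<Rightarrow> 'a \<Rightarrow> real) \<Rightarrow> real \<Rightarrow> real \<Rightarrow> 'a set" where
  "osc Y a b = {\<omega>\<in>space M. (\<forall>m. \<exists>t\<ge>m. Y t \<omega> \<le> a) \<and> (\<forall>m. \<exists>t\<ge>m. b \<le> Y t \<omega>)}"

lemma osc_sets:
  assumes "\<And>t. Y t \<in> borel_measurable M"
  shows "osc Y a b \<in> sets M"
proof -
  note [measurable] = assms
  show ?thesis unfolding osc_def by measurable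
qed

text \<open>\<open>K\<close> controls the terminal term and \<open>L\<close> the accumulated errors,
  uniformly in the starting time and the horizon, so the upcrossing bound vanishes as the required
  number of upcrossings grows.\<close>

lemma osc_null_nonneg:
  assumes V: "\<And>t. V t \<in> H_at t" and V0: "\<And>t \<omega>. 0 \<le> V t \<omega>"
    and z: "\<And>t. z t \<in> H_at t" "\<And>t \<omega>. 0 \<le> z t \<omega>"
    and sub: "\<And>t \<omega>. \<omega> \<in> space M \<Longrightarrow> V t \<omega> \<le> E t (V (Suc t)) \<omega> + z t \<omega>"
    and VK: "\<And>t. expect (V t) \<le> K" and zK: "\<And>n j. (\<Sum>i<j. expect (z (n + i))) \<le> L"
    and c: "0 < c"
  shows "expect (indicator (osc V 0 c)) = 0"
proof -
  define A where "A = osc V 0 c"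
  have AM: "A \<in> sets M"
    unfolding A_def by (intro osc_sets H_borel H_atD(1)[OF V])
  have G_le: "expect (indicator G) \<le> expect (indicator (G - A))" if G: "G \<in> sets (F n)" for G n
  proof -
    note GM = F_le_M[OF G]
    \<comment> \<open>The horizon \<open>j\<close> tends to infinity first, with the number of
      upcrossings fixed; \<open>k\<close> does so afterwards. \<open>Suc k\<close> keeps the
      denominator positive.\<close>
    have "expect (indicator G) \<le> (K + L) / (c * real (Suc k)) + expect (indicator (G - A))" for k
    proof -
      define B where "B j = {\<omega>\<in>space M. ups V c n j \<omega> < real (Suc k)}" for j
      have BM: "B j \<in> sets M" for j
      proof -
        have [measurable]: "ups V c n j \<in> borel_measurable M"
          by (intro H_borel H_atD(1)[OF ups_H[OF V]])
        show ?thesis unfolding B_def by measurable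
      qed
      have "(\<lambda>j. expect (\<lambda>\<omega>. 1 * indicator (A \<inter> B j) \<omega>)) \<longlonglongrightarrow> 0"
      proof (rule expect_indicator_LIMSEQ_0)
        show "decseq (\<lambda>j. A \<inter> B j)"
          using ups_mono[of _ _ V c n] unfolding decseq_def B_def
          by (auto intro: le_less_trans)
        have False if "\<And>j. \<omega> \<in> A \<inter> B j" for \<omega>
        proof -
          have "\<exists>j. real (Suc k) \<le> ups V c n j \<omega>"
            by (rule ups_unbounded[OF c]) (use that in \<open>auto simp: A_def osc_def\<close>)
          then show False
            using that by (auto simp: B_def not_le[symmetric])
        qed
        then show "(\<Inter>j. A \<inter> B j) = {}"
          by blast
      qed (auto intro: H_const AM BM)
      then have "(\<lambda>j. (K + L) / (c * real (Suc k)) + (expect (indicator (G - A)) + expect (indicator (A \<inter> B j))))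
          \<longlonglongrightarrow> (K + L) / (c * real (Suc k)) + (expect (indicator (G - A)) + 0)"
        by (intro tendsto_intros) simp
      moreover have "expect (indicator G)
          \<le> (K + L) / (c * real (Suc k)) + (expect (indicator (G - A)) + expect (indicator (A \<inter> B j)))" for j
      proof -
        have "expect (indicator G) \<le> (expect (V (n + j)) + (\<Sum>i<j. expect (z (n + i)))) / (c * real (Suc k))
            + expect (indicator (G \<inter> B j))"
          unfolding B_def by (intro upcrossing_bound V V0 z sub c G) auto
        also have "\<dots> \<le> (K + L) / (c * real (Suc k)) + expect (indicator (G \<inter> B j))"
          using c by (intro add_mono divide_right_mono VK zK) auto
        also have "expect (indicator (G \<inter> B j)) \<le> expect (\<lambda>\<omega>. indicator (G - A) \<omega> + indicator (A \<inter> B j) \<omega>)"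
          by (intro expect_mono H_ind H_add) (use GM AM BM in \<open>auto split: split_indicator\<close>)
        also have "\<dots> \<le> expect (indicator (G - A)) + expect (indicator (A \<inter> B j))"
          by (intro expect_add_le H_ind) (use GM AM BM in auto)
        finally show ?thesis by simp
      qed
      ultimately show ?thesis
        by (intro LIMSEQ_le_const) auto
    qed
    moreover have "(\<lambda>k. (K + L) / (c * real (Suc k)) + expect (indicator (G - A)))
        \<longlonglongrightarrow> 0 + expect (indicator (G - A))"
      using tendsto_mult_right_zero[OF LIMSEQ_inverse_real_of_nat, of "(K + L) / c"]
      by (intro tendsto_intros) (simp add: field_simps)
    ultimately show ?thesis
      by (intro LIMSEQ_le_const[of _ "expect (indicator (G - A))"]) auto
  qed
  \<comment> \<open>\<open>A\<close> is covered by \<open>sym_diff A G\<close> and \<open>G\<close>,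
    and the upper probability of \<open>G\<close> is at most that of \<open>G - A\<close>, again
    part of the symmetric difference; hence two errors of \<open>e / 2\<close>.\<close>
  have "expect (indicator A) \<le> 0 + e" if "0 < e" for e
  proof -
    have "0 < e / 2" using that by simp
    from approx_by_F[OF AM this]
    obtain n G where G: "G \<in> sets (F n)" "expect (indicator (sym_diff A G)) < e / 2"
      by blast
    note GM = F_le_M[OF G(1)]
    have "expect (indicator A) \<le> expect (\<lambda>\<omega>. indicator (sym_diff A G) \<omega> + indicator G \<omega>)"
      by (intro expect_mono H_ind H_add) (use GM AM in \<open>auto split: split_indicator\<close>)
    also have "\<dots> \<le> expect (indicator (sym_diff A G)) + expect (indicator G)"
      by (intro expect_add_le H_ind) (use GM AM in auto)
    also have "expect (indicator G) \<le> expect (indicator (G - A))"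
      by (rule G_le[OF G(1)])
    also have "\<dots> \<le> expect (indicator (sym_diff A G))"
      by (intro expect_mono H_ind) (use GM AM in \<open>auto split: split_indicator\<close>)
    finally show ?thesis using G(2) by simp
  qed
  then have "expect (indicator A) \<le> 0"
    by (rule field_le_epsilon)
  then show ?thesis
    using expect_nonneg[OF H_ind[OF AM]] by (simp add: A_def)
qed

text \<open>Passing to the positive part of \<open>Y - a\<close> keeps the inequality with the same
  errors, since \<open>E t\<close> of the positive part dominates both 0 and
  \<open>E t (Y (Suc t)) - a\<close>. The levels become 0 and \<open>b - a\<close>.\<close>

lemma osc_null:
  assumes Y: "\<And>t. Y t \<in> H_at t"
    and z: "\<And>t. z t \<in> H_at t" "\<And>t \<omega>. 0 \<le> z t \<omega>"
    and sub: "\<And>t \<omega>. \<omega> \<in> space M \<Longrightarrow> Y t \<omega> \<le> E t (Y (Suc t)) \<omega> + z t \<omega>"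
    and YK: "\<And>t. expect (\<lambda>\<omega>. \<bar>Y t \<omega>\<bar>) \<le> K" and zK: "\<And>n j. (\<Sum>i<j. expect (z (n + i))) \<le> L"
    and ab: "a < b"
  shows "expect (indicator (osc Y a b)) = 0"
proof -
  define V where "V t \<omega> = max 0 (Y t \<omega> - a)" for t \<omega>
  note YH = H_atD(1)[OF Y]
  have V: "V t \<in> H_at t" for t
    unfolding V_def[abs_def] by (intro H_at_max0 H_at_diff Y H_at_const)
  have "expect (indicator (osc V 0 (b - a))) = 0"
  proof (rule osc_null_nonneg[where z = z])
    fix t \<omega> assume w: "\<omega> \<in> space M"
    have "0 \<le> E t (V (Suc t)) \<omega>"
      by (rule E_nonneg[OF H_atD(1)[OF V] _ w]) (simp add: V_def)
    moreover have "Y t \<omega> - a \<le> E t (Y (Suc t)) \<omega> - a + z t \<omega>"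
      using sub[OF w, of t] by simp
    moreover have "E t (Y (Suc t)) \<omega> - a \<le> E t (\<lambda>\<omega>. Y (Suc t) \<omega> - a) \<omega>"
      by (intro E_diff_ge YH H_at_const w)
    moreover have "\<dots> \<le> E t (V (Suc t)) \<omega>"
      by (rule E_mono[OF H_atD(1)[OF V] H_diff[OF YH H_const] _ w]) (simp add: V_def)
    ultimately show "V t \<omega> \<le> E t (V (Suc t)) \<omega> + z t \<omega>"
      using z(2)[of t \<omega>] by (simp add: V_def)
  next
    fix t
    have "expect (V t) \<le> expect (\<lambda>\<omega>. \<bar>Y t \<omega>\<bar> + \<bar>a\<bar>)"
      by (intro expect_mono H_atD(1)[OF V] H_add H_abs YH H_const) (auto simp: V_def)
    also have "\<dots> \<le> expect (\<lambda>\<omega>. \<bar>Y t \<omega>\<bar>) + expect (\<lambda>\<omega>. \<bar>a\<bar>)"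
      by (intro expect_add_le H_abs YH H_const)
    finally show "expect (V t) \<le> K + \<bar>a\<bar>"
      using YK[of t] by (simp add: expect_const)
  qed (use V z zK ab in \<open>auto simp: V_def\<close>)
  moreover have "osc V 0 (b - a) = osc Y a b"
  proof -
    have "V t \<omega> \<le> 0 \<longleftrightarrow> Y t \<omega> \<le> a" "b - a \<le> V t \<omega> \<longleftrightarrow> b \<le> Y t \<omega>" for t \<omega>
      using ab by (auto simp: V_def)
    then show ?thesis by (simp add: osc_def)
  qed
  ultimately show ?thesis by simp
qed

end

subsection \<open>The seminorm as a supremum of integrals\<close>

text \<open>Nonemptiness matters because the empty supremum is 0 in \<open>ennreal\<close> but minus
  infinity in \<open>ereal\<close>.\<close>

lemma enn2ereal_SUP:
  assumes "I \<noteq> {}"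
  shows "enn2ereal (SUP i\<in>I. f i) = (SUP i\<in>I. enn2ereal (f i))"
proof (rule antisym)
  obtain i where "i \<in> I" using assms by blast
  then have nn: "0 \<le> (SUP i\<in>I. enn2ereal (f i))"
    by (rule SUP_upper2) simp
  have "(SUP i\<in>I. f i) \<le> e2ennreal (SUP i\<in>I. enn2ereal (f i))"
  proof (rule SUP_least)
    fix i assume "i \<in> I"
    then have "e2ennreal (enn2ereal (f i)) \<le> e2ennreal (SUP i\<in>I. enn2ereal (f i))"
      by (intro e2ennreal_mono SUP_upper)
    then show "f i \<le> e2ennreal (SUP i\<in>I. enn2ereal (f i))" by simp
  qed
  then show "enn2ereal (SUP i\<in>I. f i) \<le> (SUP i\<in>I. enn2ereal (f i))"
    using enn2ereal_e2ennreal[OF nn] by (simp add: less_eq_ennreal.rep_eq)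
  show "(SUP i\<in>I. enn2ereal (f i)) \<le> enn2ereal (SUP i\<in>I. f i)"
    by (intro SUP_least) (simp add: less_eq_ennreal.rep_eq[symmetric] SUP_upper)
qed

lemma ext_integral_nonneg:
  assumes "\<And>\<omega>. \<omega> \<in> space \<theta> \<Longrightarrow> 0 \<le> X \<omega>"
  shows "ext_integral \<theta> X = enn2ereal (\<integral>\<^sup>+\<omega>. e2ennreal (X \<omega>) \<partial>\<theta>)"
proof -
  have "(\<integral>\<^sup>+\<omega>. e2ennreal (- X \<omega>) \<partial>\<theta>) = (\<integral>\<^sup>+\<omega>. 0 \<partial>\<theta>)"
    by (rule nn_integral_cong) (use assms in \<open>auto simp: e2ennreal_neg\<close>)
  then show ?thesis
    by (simp add: ext_integral_def zero_ennreal.rep_eq)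
qed

text \<open>For infinite \<open>x\<close> the right-hand side is infinite, and for finite
  \<open>x\<close> this is the real triangle inequality. The same distinction settles the next three
  inequalities.\<close>

lemma e2ennreal_dist_triangle:
  fixes x :: ereal
  shows "e2ennreal \<bar>ereal y - x\<bar> \<le> ennreal \<bar>y - y'\<bar> + e2ennreal \<bar>ereal y' - x\<bar>"
  by (cases x) (auto simp flip: ennreal_plus intro!: ennreal_leI)

lemma ennreal_dist_triangle:
  fixes x :: ereal
  shows "ennreal \<bar>y - y'\<bar> \<le> e2ennreal \<bar>ereal y - x\<bar> + e2ennreal \<bar>ereal y' - x\<bar>"
  by (cases x) (auto simp flip: ennreal_plus intro!: ennreal_leI)

lemma e2ennreal_abs_le:
  fixes x :: ereal
  shows "e2ennreal \<bar>x\<bar> \<le> e2ennreal \<bar>ereal y - x\<bar> + ennreal \<bar>y\<bar>"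
  by (cases x) (auto simp flip: ennreal_plus intro!: ennreal_leI)

lemma e2ennreal_abs_abs_le:
  fixes x :: ereal
  shows "e2ennreal \<bar>ereal \<bar>y\<bar> - \<bar>x\<bar>\<bar> \<le> e2ennreal \<bar>ereal y - x\<bar>"
  by (cases x) (auto intro!: ennreal_leI)

lemma ennreal_suminf_LIMSEQ_0:
  fixes f :: "nat \<Rightarrow> ennreal"
  assumes "(\<Sum>n. f n) \<noteq> \<top>"
  shows "f \<longlonglongrightarrow> 0"
proof -
  have *: "f n \<noteq> \<top>" for n
    using assms ennreal_suminf_lessD[of f \<top> n] by (auto simp: less_top)
  then have eq: "f = (\<lambda>n. ennreal (enn2real (f n)))"
    by (auto simp: fun_eq_iff less_top)
  have "summable (\<lambda>n. enn2real (f n))"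
    by (rule summable_suminf_not_top) (use assms eq in auto)
  then have "(\<lambda>n. ennreal (enn2real (f n))) \<longlonglongrightarrow> ennreal 0"
    by (intro tendsto_ennrealI summable_LIMSEQ_zero)
  then show ?thesis
    using eq by simp
qed

section \<open>Upper expectation of nonnegative functions and completeness\<close>

context sl_representation
begin

text \<open>With values in \<open>ennreal\<close> no difference of infinities can occur. On
  nonnegative functions both \<open>expect\<close> and \<open>expect_ext\<close> reduce to
  it.\<close>

definition qnorm :: "('a \<Rightarrow> ennreal) \<Rightarrow> ennreal" where
  "qnorm f = (SUP \<theta>\<in>\<Theta>. \<integral>\<^sup>+\<omega>. f \<omega> \<partial>\<theta>)"

lemma borel_Theta: "\<theta> \<in> \<Theta> \<Longrightarrow> f \<in> borel_measurable M \<longleftrightarrow> f \<in> borel_measurable \<theta>"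
  using measurable_cong_sets[OF Theta_sets refl] by blast

lemma nn_integral_le_qnorm: "\<theta> \<in> \<Theta> \<Longrightarrow> (\<integral>\<^sup>+\<omega>. f \<omega> \<partial>\<theta>) \<le> qnorm f"
  unfolding qnorm_def by (rule SUP_upper)

lemma qnorm_mono_AE: "(\<And>\<theta>. \<theta> \<in> \<Theta> \<Longrightarrow> AE \<omega> in \<theta>. f \<omega> \<le> g \<omega>) \<Longrightarrow> qnorm f \<le> qnorm g"
  unfolding qnorm_def by (intro SUP_mono) (auto intro: nn_integral_mono_AE)

lemma qnorm_mono: "(\<And>\<omega>. \<omega> \<in> space M \<Longrightarrow> f \<omega> \<le> g \<omega>) \<Longrightarrow> qnorm f \<le> qnorm g"
  by (intro qnorm_mono_AE AE_I2) (simp add: Theta_space)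

lemma qnorm_add:
  assumes "f \<in> borel_measurable M" "g \<in> borel_measurable M"
  shows "qnorm (\<lambda>\<omega>. f \<omega> + g \<omega>) \<le> qnorm f + qnorm g"
  unfolding qnorm_def[of "\<lambda>\<omega>. f \<omega> + g \<omega>"]
proof (rule SUP_least)
  fix \<theta> assume th: "\<theta> \<in> \<Theta>"
  have "(\<integral>\<^sup>+\<omega>. f \<omega> + g \<omega> \<partial>\<theta>) = (\<integral>\<^sup>+\<omega>. f \<omega> \<partial>\<theta>) + (\<integral>\<^sup>+\<omega>. g \<omega> \<partial>\<theta>)"
    using assms th by (intro nn_integral_add) (auto simp: borel_Theta)
  also have "\<dots> \<le> qnorm f + qnorm g"
    by (intro add_mono nn_integral_le_qnorm th)
  finally show "(\<integral>\<^sup>+\<omega>. f \<omega> + g \<omega> \<partial>\<theta>) \<le> qnorm f + qnorm g" .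
qed

lemma qnorm_const: "qnorm (\<lambda>_. c) = c"
proof -
  have "qnorm (\<lambda>_. c) = (SUP \<theta>\<in>\<Theta>. c)"
    unfolding qnorm_def
    by (intro SUP_cong refl) (simp add: prob_space.emeasure_space_1 Theta_prob)
  then show ?thesis
    using Theta_nonempty by simp
qed

lemma ennreal_expect:
  assumes X: "X \<in> H" and X0: "\<And>\<omega>. \<omega> \<in> space M \<Longrightarrow> 0 \<le> X \<omega>"
  shows "ennreal (expect X) = qnorm (\<lambda>\<omega>. ennreal (X \<omega>))"
proof -
  have "ereal (expect X) = (SUP \<theta>\<in>\<Theta>. enn2ereal (\<integral>\<^sup>+\<omega>. ennreal (X \<omega>) \<partial>\<theta>))"
    unfolding representation[OF X]
  proof (intro SUP_cong refl)
    fix \<theta> assume "\<theta> \<in> \<Theta>"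
    then show "ext_integral \<theta> (\<lambda>\<omega>. ereal (X \<omega>)) = enn2ereal (\<integral>\<^sup>+\<omega>. ennreal (X \<omega>) \<partial>\<theta>)"
      using ext_integral_nonneg[of \<theta> "\<lambda>\<omega>. ereal (X \<omega>)"] X0 by (simp add: Theta_space)
  qed
  also have "\<dots> = enn2ereal (qnorm (\<lambda>\<omega>. ennreal (X \<omega>)))"
    unfolding qnorm_def by (rule enn2ereal_SUP[symmetric, OF Theta_nonempty])
  finally have "e2ennreal (ereal (expect X)) = e2ennreal (enn2ereal (qnorm (\<lambda>\<omega>. ennreal (X \<omega>))))"
    by simp
  then show ?thesis by simp
qed

lemma expect_ext_nonneg:
  assumes "\<And>\<omega>. 0 \<le> X \<omega>"
  shows "expect_ext X = enn2ereal (qnorm (\<lambda>\<omega>. e2ennreal (X \<omega>)))"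
  unfolding expect_ext_def qnorm_def enn2ereal_SUP[OF Theta_nonempty]
  by (intro SUP_cong refl ext_integral_nonneg assms)

text \<open>A Borel-Cantelli argument under each single \<theta>: the integral of the sum is at most
  a geometric series.\<close>

lemma AE_suminf_finite:
  assumes f: "\<And>n. f n \<in> borel_measurable M" and le: "\<And>n. qnorm (f n) \<le> ennreal ((1/2)^n)"
    and th: "\<theta> \<in> \<Theta>"
  shows "AE \<omega> in \<theta>. (\<Sum>n. f n \<omega>) \<noteq> \<top>"
proof -
  have [measurable]: "f n \<in> borel_measurable \<theta>" for n
    using f th by (simp add: borel_Theta)
  have "(\<integral>\<^sup>+\<omega>. (\<Sum>n. f n \<omega>) \<partial>\<theta>) = (\<Sum>n. \<integral>\<^sup>+\<omega>. f n \<omega> \<partial>\<theta>)"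
    by (intro nn_integral_suminf) simp
  also have "\<dots> \<le> (\<Sum>n. ennreal ((1/2)^n))"
    by (intro suminf_le order.trans[OF nn_integral_le_qnorm[OF th] le]) auto
  also have "\<dots> = ennreal (\<Sum>n. (1/2)^n)"
    by (intro suminf_ennreal2) (auto intro: summable_geometric)
  also have "\<dots> < \<top>" by simp
  finally have "(\<integral>\<^sup>+\<omega>. (\<Sum>n. f n \<omega>) \<partial>\<theta>) \<noteq> \<infinity>" by simp
  then show ?thesis
    using nn_integral_PInf_AE[of "\<lambda>\<omega>. \<Sum>n. f n \<omega>" \<theta>] by simp
qed

text \<open>The exceptional set has upper expectation 0, which dominates its probability under each
  \<theta>.\<close>

lemma quasi_surely_AE:
  assumes "quasi_surely P" and th: "\<theta> \<in> \<Theta>"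
  shows "AE \<omega> in \<theta>. P \<omega>"
proof -
  obtain N where N: "N \<in> sets M" "expect (indicator N) = 0" "\<forall>\<omega>\<in>space M - N. P \<omega>"
    using assms unfolding quasi_surely_def by blast
  have "emeasure \<theta> N \<le> qnorm (\<lambda>\<omega>. ennreal (indicator N \<omega>))"
    using nn_integral_le_qnorm[OF th, of "indicator N"] N(1) Theta_sets[OF th]
    by (simp add: ennreal_indicator)
  also have "\<dots> = 0"
    using ennreal_expect[OF H_ind[OF N(1)]] N(2) by simp
  finally have "N \<in> null_sets \<theta>"
    using N(1) Theta_sets[OF th] by auto
  then show ?thesis
    by (rule AE_I') (use N(3) Theta_space[OF th] in auto)
qed

text \<open>The null sets of the various \<theta> may differ, but the measurable set where
  \<open>P\<close> fails is null under all of them and serves as the common exceptional set.\<close>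

lemma quasi_surelyI:
  assumes m: "{\<omega>\<in>space M. P \<omega>} \<in> sets M" and AE: "\<And>\<theta>. \<theta> \<in> \<Theta> \<Longrightarrow> AE \<omega> in \<theta>. P \<omega>"
  shows "quasi_surely P"
proof -
  define N where "N = space M - {\<omega>\<in>space M. P \<omega>}"
  have N: "N \<in> sets M"
    unfolding N_def using m by auto
  have "ennreal (expect (indicator N)) = qnorm (\<lambda>\<omega>. ennreal (indicator N \<omega>))"
    by (rule ennreal_expect[OF H_ind[OF N]]) simp
  also have "\<dots> \<le> qnorm (\<lambda>_. 0)"
  proof (rule qnorm_mono_AE)
    fix \<theta> assume "\<theta> \<in> \<Theta>"
    from AE[OF this] show "AE \<omega> in \<theta>. ennreal (indicator N \<omega>) \<le> 0"
      by eventually_elim (auto simp: N_def)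
  qed
  finally have "expect (indicator N) = 0"
    using expect_nonneg[OF H_ind[OF N]] by (simp add: qnorm_const ennreal_eq_0_iff)
  then show ?thesis
    unfolding quasi_surely_def using N by (auto simp: N_def)
qed

text \<open>The distance of the seminorm between an element of \<open>H\<close> and a representative
  in \<open>L1\<close>; a real first argument keeps the difference meaningful where \<open>X\<close>
  is infinite.\<close>

definition dist1 :: "('a \<Rightarrow> real) \<Rightarrow> ('a \<Rightarrow> ereal) \<Rightarrow> ennreal" where
  "dist1 Y X = qnorm (\<lambda>\<omega>. e2ennreal \<bar>ereal (Y \<omega>) - X \<omega>\<bar>)"

lemma tendsto_L1_iff: "tendsto_L1 Y X \<longleftrightarrow> (\<lambda>n. dist1 (Y n) X) \<longlonglongrightarrow> 0"
proof -
  have "tendsto_L1 Y X \<longleftrightarrow> (\<lambda>n. enn2ereal (dist1 (Y n) X)) \<longlonglongrightarrow> enn2ereal 0"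
    by (simp add: tendsto_L1_def expect_ext_nonneg dist1_def zero_ennreal.rep_eq)
  then show ?thesis by simp
qed

lemma dist_borel:
  assumes "Y \<in> borel_measurable M" "X \<in> borel_measurable M"
  shows "(\<lambda>\<omega>. e2ennreal \<bar>ereal (Y \<omega>) - X \<omega>\<bar>) \<in> borel_measurable M"
  using assms by measurable

lemma ennreal_expect_abs_diff:
  assumes "Y \<in> H" "Y' \<in> H"
  shows "ennreal (expect (\<lambda>\<omega>. \<bar>Y \<omega> - Y' \<omega>\<bar>)) = qnorm (\<lambda>\<omega>. ennreal \<bar>Y \<omega> - Y' \<omega>\<bar>)"
  by (intro ennreal_expect H_abs H_diff assms) auto

lemma abs_diff_borel:
  assumes "Y \<in> H" "Y' \<in> H"
  shows "(\<lambda>\<omega>. ennreal \<bar>Y \<omega> - Y' \<omega>\<bar>) \<in> borel_measurable M"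
  using H_borel[OF assms(1)] H_borel[OF assms(2)] by measurable

lemma dist1_triangle:
  assumes "Y \<in> H" "Y' \<in> H" "X \<in> borel_measurable M"
  shows "dist1 Y X \<le> ennreal (expect (\<lambda>\<omega>. \<bar>Y \<omega> - Y' \<omega>\<bar>)) + dist1 Y' X"
proof -
  have "dist1 Y X \<le> qnorm (\<lambda>\<omega>. ennreal \<bar>Y \<omega> - Y' \<omega>\<bar> + e2ennreal \<bar>ereal (Y' \<omega>) - X \<omega>\<bar>)"
    unfolding dist1_def by (intro qnorm_mono e2ennreal_dist_triangle)
  also have "\<dots> \<le> qnorm (\<lambda>\<omega>. ennreal \<bar>Y \<omega> - Y' \<omega>\<bar>) + dist1 Y' X"
    unfolding dist1_def by (intro qnorm_add dist_borel abs_diff_borel H_borel assms)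
  finally show ?thesis
    by (simp add: ennreal_expect_abs_diff assms)
qed

lemma expect_triangle_dist1:
  assumes "Y \<in> H" "Y' \<in> H" "X \<in> borel_measurable M"
  shows "ennreal (expect (\<lambda>\<omega>. \<bar>Y \<omega> - Y' \<omega>\<bar>)) \<le> dist1 Y X + dist1 Y' X"
proof -
  have "qnorm (\<lambda>\<omega>. ennreal \<bar>Y \<omega> - Y' \<omega>\<bar>)
      \<le> qnorm (\<lambda>\<omega>. e2ennreal \<bar>ereal (Y \<omega>) - X \<omega>\<bar> + e2ennreal \<bar>ereal (Y' \<omega>) - X \<omega>\<bar>)"
    by (intro qnorm_mono ennreal_dist_triangle)
  also have "\<dots> \<le> dist1 Y X + dist1 Y' X"
    unfolding dist1_def by (intro qnorm_add dist_borel H_borel assms)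
  finally show ?thesis
    by (simp add: ennreal_expect_abs_diff assms)
qed

lemma tendsto_imp_H_Cauchy:
  assumes Y: "\<And>n. Y n \<in> H" and X: "X \<in> borel_measurable M" and lim: "(\<lambda>n. dist1 (Y n) X) \<longlonglongrightarrow> 0"
  shows "H_Cauchy Y"
  unfolding H_Cauchy_def
proof (intro conjI allI impI Y)
  fix e :: real assume e: "0 < e"
  then obtain N where N: "dist1 (Y n) X < ennreal (e / 2)" if "n \<ge> N" for n
    using order_tendstoD(2)[OF lim, of "ennreal (e / 2)"] by (auto simp: eventually_sequentially)
  have "expect (\<lambda>\<omega>. \<bar>Y m \<omega> - Y n \<omega>\<bar>) < e" if "m \<ge> N" "n \<ge> N" for m n
  proof -
    have "ennreal (expect (\<lambda>\<omega>. \<bar>Y m \<omega> - Y n \<omega>\<bar>)) \<le> dist1 (Y m) X + dist1 (Y n) X"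
      by (intro expect_triangle_dist1 Y X)
    also have "\<dots> < ennreal (e / 2) + ennreal (e / 2)"
      using N that by (intro add_strict_mono) auto
    also have "\<dots> = ennreal e"
      using e by (simp flip: ennreal_plus)
    finally show ?thesis
      using e by (simp add: ennreal_less_iff expect_nonneg H_abs H_diff Y)
  qed
  then show "\<exists>N. \<forall>m\<ge>N. \<forall>n\<ge>N. expect (\<lambda>\<omega>. \<bar>Y m \<omega> - Y n \<omega>\<bar>) < e"
    by blast
qed

text \<open>The integral of the positive part is bounded by that of the absolute value, and one
  finite part makes the minimum finite.\<close>

lemma H_extI:
  assumes X: "X \<in> borel_measurable M" and fin: "qnorm (\<lambda>\<omega>. e2ennreal \<bar>X \<omega>\<bar>) < \<top>"
  shows "X \<in> H_ext"
proof -
  have "(\<integral>\<^sup>+\<omega>. e2ennreal (X \<omega>) \<partial>\<theta>) < \<top>" if th: "\<theta> \<in> \<Theta>" for \<theta>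
  proof -
    have "(\<integral>\<^sup>+\<omega>. e2ennreal (X \<omega>) \<partial>\<theta>) \<le> (\<integral>\<^sup>+\<omega>. e2ennreal \<bar>X \<omega>\<bar> \<partial>\<theta>)"
      by (intro nn_integral_mono e2ennreal_mono) (rename_tac \<omega>, case_tac "X \<omega>", auto)
    also note nn_integral_le_qnorm[OF th]
    also note fin
    finally show ?thesis .
  qed
  then show ?thesis
    unfolding H_ext_def using X by (auto simp: min_less_iff_disj)
qed

lemma qnorm_abs_le_dist1:
  assumes "Y \<in> H" "X \<in> borel_measurable M"
  shows "qnorm (\<lambda>\<omega>. e2ennreal \<bar>X \<omega>\<bar>) \<le> dist1 Y X + ennreal (expect (\<lambda>\<omega>. \<bar>Y \<omega>\<bar>))"
proof -
  have "qnorm (\<lambda>\<omega>. e2ennreal \<bar>X \<omega>\<bar>) \<le> qnorm (\<lambda>\<omega>. e2ennreal \<bar>ereal (Y \<omega>) - X \<omega>\<bar> + ennreal \<bar>Y \<omega>\<bar>)"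
    by (intro qnorm_mono e2ennreal_abs_le)
  also have "\<dots> \<le> dist1 Y X + qnorm (\<lambda>\<omega>. ennreal \<bar>Y \<omega>\<bar>)"
    unfolding dist1_def
    by (intro qnorm_add dist_borel H_borel assms) (use H_borel[OF assms(1)] in measurable)
  finally show ?thesis
    using assms by (simp add: ennreal_expect H_abs)
qed

text \<open>Fatou's lemma holds under each \<theta>, and the bound \<open>e\<close> is uniform, so
  it survives the supremum.\<close>

lemma qnorm_Fatou:
  fixes W :: "nat \<Rightarrow> 'a \<Rightarrow> real"
  assumes W: "\<And>j. W j \<in> borel_measurable M"
    and lim: "\<And>\<theta>. \<theta> \<in> \<Theta> \<Longrightarrow> AE \<omega> in \<theta>. (\<lambda>j. ereal (W j \<omega>)) \<longlonglongrightarrow> Z \<omega>"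
    and le: "\<And>j. m \<le> j \<Longrightarrow> qnorm (\<lambda>\<omega>. ennreal \<bar>W j \<omega>\<bar>) \<le> e"
  shows "qnorm (\<lambda>\<omega>. e2ennreal \<bar>Z \<omega>\<bar>) \<le> e"
  unfolding qnorm_def
proof (rule SUP_least)
  fix \<theta> assume th: "\<theta> \<in> \<Theta>"
  have [measurable]: "W j \<in> borel_measurable \<theta>" for j
    using W th by (simp add: borel_Theta)
  have "(\<integral>\<^sup>+\<omega>. e2ennreal \<bar>Z \<omega>\<bar> \<partial>\<theta>) = (\<integral>\<^sup>+\<omega>. liminf (\<lambda>j. ennreal \<bar>W j \<omega>\<bar>) \<partial>\<theta>)"
  proof (rule nn_integral_cong_AE)
    show "AE \<omega> in \<theta>. e2ennreal \<bar>Z \<omega>\<bar> = liminf (\<lambda>j. ennreal \<bar>W j \<omega>\<bar>)"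
      using lim[OF th]
    proof eventually_elim
      case (elim \<omega>)
      then have "(\<lambda>j. e2ennreal \<bar>ereal (W j \<omega>)\<bar>) \<longlonglongrightarrow> e2ennreal \<bar>Z \<omega>\<bar>"
        by (intro tendsto_e2ennrealI tendsto_abs_ereal)
      then show ?case
        by (intro lim_imp_Liminf[symmetric]) auto
    qed
  qed
  also have "\<dots> \<le> liminf (\<lambda>j. \<integral>\<^sup>+\<omega>. ennreal \<bar>W j \<omega>\<bar> \<partial>\<theta>)"
    by (rule nn_integral_liminf) measurable
  also have "\<dots> \<le> limsup (\<lambda>j. \<integral>\<^sup>+\<omega>. ennreal \<bar>W j \<omega>\<bar> \<partial>\<theta>)"
    by (rule Liminf_le_Limsup) simp
  also have "\<dots> \<le> e"
    by (intro Limsup_bounded eventually_sequentiallyI[of m])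
      (blast intro: order.trans nn_integral_le_qnorm[OF th] le)
  finally show "(\<integral>\<^sup>+\<omega>. e2ennreal \<bar>Z \<omega>\<bar> \<partial>\<theta>) \<le> e" .
qed

text \<open>The Riesz-Fischer argument: a rapidly converging subsequence converges almost everywhere
  under every \<theta>, and Fatou's lemma carries the Cauchy estimate over to its limit.\<close>

lemma complete_H_at:
  assumes Y: "\<And>n. Y n \<in> H_at t" and C: "H_Cauchy Y"
  shows "\<exists>Z \<in> H_ext \<inter> borel_measurable (F t). (\<lambda>n. dist1 (Y n) Z) \<longlonglongrightarrow> 0"
proof -
  note YH = H_atD(1)[OF Y]
  have "\<exists>N. \<forall>m\<ge>N. \<forall>n\<ge>N. expect (\<lambda>\<omega>. \<bar>Y m \<omega> - Y n \<omega>\<bar>) < (1/2)^j" for j :: nat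
    using C unfolding H_Cauchy_def by (metis half_gt_zero_iff zero_less_one zero_less_power)
  then obtain N where N: "\<And>j m n. m \<ge> N j \<Longrightarrow> n \<ge> N j \<Longrightarrow> expect (\<lambda>\<omega>. \<bar>Y m \<omega> - Y n \<omega>\<bar>) < (1/2)^j"
    by metis
  \<comment> \<open>This choice is increasing, dominates \<open>N j\<close> for the geometric
    bounds, and dominates \<open>j\<close> so that the subsequence tends to infinity.\<close>
  define r where "r j = j + (\<Sum>i\<le>j. N i)" for j
  have rN: "N j \<le> r j" for j
    unfolding r_def using member_le_sum[of j "{..j}" N] by simp
  have rS: "r j \<le> r (Suc j)" for j
    by (simp add: r_def)
  \<comment> \<open>The lower limit is defined everywhere, so \<open>Z\<close> is
    \<open>F t\<close>-measurable and the same function for all \<theta>.\<close>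
  define Z where "Z \<omega> = liminf (\<lambda>j. ereal (Y (r j) \<omega>))" for \<omega>
  have [measurable]: "Y n \<in> borel_measurable (F t)" for n
    using H_atD(2)[OF Y] .
  have ZF: "Z \<in> borel_measurable (F t)"
    unfolding Z_def[abs_def] by measurable
  note ZM = borel_F_le_M[OF ZF]
  have conv: "AE \<omega> in \<theta>. (\<lambda>j. ereal (Y (r j) \<omega>)) \<longlonglongrightarrow> Z \<omega>" if th: "\<theta> \<in> \<Theta>" for \<theta>
  proof -
    have "qnorm (\<lambda>\<omega>. ennreal \<bar>Y (r (Suc j)) \<omega> - Y (r j) \<omega>\<bar>) \<le> ennreal ((1/2)^j)" for j
      unfolding ennreal_expect_abs_diff[OF YH YH, symmetric]
      using N[of j "r (Suc j)" "r j"] rN[of j] rS[of j] by (intro ennreal_leI) auto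
    then have "AE \<omega> in \<theta>. (\<Sum>j. ennreal \<bar>Y (r (Suc j)) \<omega> - Y (r j) \<omega>\<bar>) \<noteq> \<top>"
      by (intro AE_suminf_finite abs_diff_borel YH th)
    then show ?thesis
    proof eventually_elim
      fix \<omega> assume "(\<Sum>j. ennreal \<bar>Y (r (Suc j)) \<omega> - Y (r j) \<omega>\<bar>) \<noteq> \<top>"
      then have "summable (\<lambda>j. \<bar>Y (r (Suc j)) \<omega> - Y (r j) \<omega>\<bar>)"
        by (intro summable_suminf_not_top) auto
      then have "summable (\<lambda>j. Y (r (Suc j)) \<omega> - Y (r j) \<omega>)"
        by (rule summable_rabs_cancel)
      then obtain s where "(\<lambda>n. \<Sum>j<n. Y (r (Suc j)) \<omega> - Y (r j) \<omega>) \<longlonglongrightarrow> s"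
        using summable_LIMSEQ by blast
      then have "(\<lambda>n. Y (r n) \<omega> - Y (r 0) \<omega>) \<longlonglongrightarrow> s"
        by (simp add: sum_lessThan_telescope[of "\<lambda>j. Y (r j) \<omega>"])
      then have "(\<lambda>n. (Y (r n) \<omega> - Y (r 0) \<omega>) + Y (r 0) \<omega>) \<longlonglongrightarrow> s + Y (r 0) \<omega>"
        by (intro tendsto_intros)
      then have *: "(\<lambda>j. ereal (Y (r j) \<omega>)) \<longlonglongrightarrow> ereal (s + Y (r 0) \<omega>)"
        by (simp add: tendsto_ereal)
      have "Z \<omega> = ereal (s + Y (r 0) \<omega>)"
        unfolding Z_def by (rule lim_imp_Liminf[OF _ *]) simp
      then show "(\<lambda>j. ereal (Y (r j) \<omega>)) \<longlonglongrightarrow> Z \<omega>"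
        using * by simp
    qed
  qed
  have dist_le: "dist1 (Y m) Z \<le> ennreal e"
    if e: "\<And>n. n \<ge> N' \<Longrightarrow> expect (\<lambda>\<omega>. \<bar>Y m \<omega> - Y n \<omega>\<bar>) \<le> e" for m N' e
    unfolding dist1_def
  proof (rule qnorm_Fatou[where W = "\<lambda>j \<omega>. Y m \<omega> - Y (r j) \<omega>" and m = N'])
    show "(\<lambda>\<omega>. Y m \<omega> - Y (r j) \<omega>) \<in> borel_measurable M" for j
      by (intro H_borel H_diff YH)
    fix \<theta> assume "\<theta> \<in> \<Theta>"
    from conv[OF this]
    show "AE \<omega> in \<theta>. (\<lambda>j. ereal (Y m \<omega> - Y (r j) \<omega>)) \<longlonglongrightarrow> ereal (Y m \<omega>) - Z \<omega>"
    proof eventually_elim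
      case (elim \<omega>)
      then have "(\<lambda>j. ereal (Y m \<omega>) - ereal (Y (r j) \<omega>)) \<longlonglongrightarrow> ereal (Y m \<omega>) - Z \<omega>"
        by (intro tendsto_diff_ereal_general tendsto_const) auto
      then show ?case by simp
    qed
  next
    fix j assume "N' \<le> j"
    then have "N' \<le> r j" by (simp add: r_def)
    then show "qnorm (\<lambda>\<omega>. ennreal \<bar>Y m \<omega> - Y (r j) \<omega>\<bar>) \<le> ennreal e"
      unfolding ennreal_expect_abs_diff[OF YH YH, symmetric] by (intro ennreal_leI e)
  qed
  have lim: "(\<lambda>n. dist1 (Y n) Z) \<longlonglongrightarrow> 0"
  proof (rule order_tendstoI)
    fix a :: ennreal assume "0 < a"
    then obtain b where b: "0 < b" "b < a" using dense by blast
    then obtain e where e: "b = ennreal e" "0 < e"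
      by (cases b) (auto simp: top_unique less_le)
    obtain N' where "\<And>m n. m \<ge> N' \<Longrightarrow> n \<ge> N' \<Longrightarrow> expect (\<lambda>\<omega>. \<bar>Y m \<omega> - Y n \<omega>\<bar>) < e"
      using C e unfolding H_Cauchy_def by blast
    then have "dist1 (Y n) Z \<le> ennreal e" if "n \<ge> N'" for n
      using that by (intro dist_le[of N']) (auto intro: less_imp_le)
    then show "\<forall>\<^sub>F n in sequentially. dist1 (Y n) Z < a"
      using b e by (auto simp: eventually_sequentially intro: le_less_trans)
  qed simp
  have "Z \<in> H_ext"
  proof (rule H_extI[OF ZM])
    obtain m where "dist1 (Y m) Z < 1"
      using order_tendstoD(2)[OF lim, of 1] by (auto simp: eventually_sequentially)
    then have "dist1 (Y m) Z + ennreal (expect (\<lambda>\<omega>. \<bar>Y m \<omega>\<bar>)) < \<top>"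
      by (auto simp: ennreal_add_eq_top less_top[symmetric])
    then show "qnorm (\<lambda>\<omega>. e2ennreal \<bar>Z \<omega>\<bar>) < \<top>"
      using qnorm_abs_le_dist1[OF YH ZM, of m] by (rule le_less_trans[rotated])
  qed
  then show ?thesis
    using ZF lim by blast
qed

end

subsection \<open>The extension of \<open>E\<close> to \<open>L1\<close>\<close>

context sl_representation
begin

lemma L1D:
  assumes "X \<in> L1"
  shows "X \<in> borel_measurable M" "X \<in> H_ext" "\<exists>Y. L1_approx Y X"
  using assms by (auto simp: L1_def H_ext_def)

lemma L1_approxD:
  assumes "L1_approx Y X"
  shows "Y n \<in> H" "(\<lambda>n. dist1 (Y n) X) \<longlonglongrightarrow> 0" "H_Cauchy Y"
  using assms by (auto simp: L1_approx_def H_Cauchy_def tendsto_L1_iff)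

lemma L1_approxI:
  "(\<And>n. Y n \<in> H) \<Longrightarrow> X \<in> borel_measurable M \<Longrightarrow> (\<lambda>n. dist1 (Y n) X) \<longlonglongrightarrow> 0 \<Longrightarrow> L1_approx Y X"
  by (simp add: L1_approx_def tendsto_L1_iff tendsto_imp_H_Cauchy)

text \<open>Because \<open>E t\<close> is a contraction, it maps one approximating sequence to a
  Cauchy sequence, whose limit exists by completeness, and every other approximating sequence to one
  with the same limit. Hence the choice in \<open>E_L1\<close> has a candidate.\<close>

lemma E_L1_spec:
  assumes X: "X \<in> L1"
  shows "E_L1 t X \<in> L1 \<inter> borel_measurable (F t)"
    and "L1_approx Y X \<Longrightarrow> (\<lambda>n. dist1 (E t (Y n)) (E_L1 t X)) \<longlonglongrightarrow> 0"
proof -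
  note XM = L1D(1)[OF X]
  obtain Y0 where Y0: "L1_approx Y0 X"
    using L1D(3)[OF X] by blast
  note Y0H = L1_approxD(1)[OF Y0]
  have "H_Cauchy (\<lambda>n. E t (Y0 n))"
    using L1_approxD(3)[OF Y0] expect_abs_E_diff_le[OF Y0H Y0H] E_in_H[OF Y0H]
    unfolding H_Cauchy_def by (meson le_less_trans)
  then obtain Z where Z: "Z \<in> H_ext" "Z \<in> borel_measurable (F t)" "(\<lambda>n. dist1 (E t (Y0 n)) Z) \<longlonglongrightarrow> 0"
    using complete_H_at[of "\<lambda>n. E t (Y0 n)" t] E_H[OF Y0H] by blast
  note ZM = borel_F_le_M[OF Z(2)]
  have ZL: "Z \<in> L1"
    using Z(1) L1_approxI[OF E_in_H[OF Y0H] ZM Z(3)] by (auto simp: L1_def)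
  have "tendsto_L1 (\<lambda>n. E t (Y n)) Z" if Y: "L1_approx Y X" for Y
    unfolding tendsto_L1_iff
  proof (rule tendsto_sandwich[OF _ _ tendsto_const])
    note YH = L1_approxD(1)[OF Y]
    have "(\<lambda>n. (dist1 (Y n) X + dist1 (Y0 n) X) + dist1 (E t (Y0 n)) Z) \<longlonglongrightarrow> (0 + 0) + 0"
      by (intro tendsto_add L1_approxD(2)[OF Y] L1_approxD(2)[OF Y0] Z(3))
    then show "(\<lambda>n. (dist1 (Y n) X + dist1 (Y0 n) X) + dist1 (E t (Y0 n)) Z) \<longlonglongrightarrow> 0"
      by simp
    have "dist1 (E t (Y n)) Z \<le> (dist1 (Y n) X + dist1 (Y0 n) X) + dist1 (E t (Y0 n)) Z" for n
    proof -
      have "dist1 (E t (Y n)) Z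
          \<le> ennreal (expect (\<lambda>\<omega>. \<bar>E t (Y n) \<omega> - E t (Y0 n) \<omega>\<bar>)) + dist1 (E t (Y0 n)) Z"
        by (intro dist1_triangle E_in_H YH Y0H ZM)
      also have "ennreal (expect (\<lambda>\<omega>. \<bar>E t (Y n) \<omega> - E t (Y0 n) \<omega>\<bar>))
          \<le> ennreal (expect (\<lambda>\<omega>. \<bar>Y n \<omega> - Y0 n \<omega>\<bar>))"
        by (intro ennreal_leI expect_abs_E_diff_le YH Y0H)
      also have "\<dots> \<le> dist1 (Y n) X + dist1 (Y0 n) X"
        by (intro expect_triangle_dist1 YH Y0H XM)
      finally show ?thesis by (simp add: add_right_mono)
    qed
    then show "\<forall>\<^sub>F n in sequentially. dist1 (E t (Y n)) Z
        \<le> (dist1 (Y n) X + dist1 (Y0 n) X) + dist1 (E t (Y0 n)) Z"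
      by simp
  qed simp
  then have "\<exists>Z. Z \<in> L1 \<inter> borel_measurable (F t) \<and>
      (\<forall>Y. L1_approx Y X \<longrightarrow> tendsto_L1 (\<lambda>n. E t (Y n)) Z)"
    using ZL Z(2) by blast
  then have "E_L1 t X \<in> L1 \<inter> borel_measurable (F t) \<and>
      (\<forall>Y. L1_approx Y X \<longrightarrow> tendsto_L1 (\<lambda>n. E t (Y n)) (E_L1 t X))"
    unfolding E_L1_def by (rule someI_ex)
  then show "E_L1 t X \<in> L1 \<inter> borel_measurable (F t)"
    "L1_approx Y X \<Longrightarrow> (\<lambda>n. dist1 (E t (Y n)) (E_L1 t X)) \<longlonglongrightarrow> 0"
    by (auto simp: tendsto_L1_iff)
qed

lemma L1_approx_abs:
  assumes X: "X \<in> L1" and Y: "L1_approx Y X"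
  shows "(\<lambda>\<omega>. \<bar>X \<omega>\<bar>) \<in> L1" "L1_approx (\<lambda>n \<omega>. \<bar>Y n \<omega>\<bar>) (\<lambda>\<omega>. \<bar>X \<omega>\<bar>)"
proof -
  note YH = L1_approxD(1)[OF Y] and lim = L1_approxD(2)[OF Y]
  have [measurable]: "X \<in> borel_measurable M" by (rule L1D(1)[OF X])
  have le: "dist1 (\<lambda>\<omega>. \<bar>Y n \<omega>\<bar>) (\<lambda>\<omega>. \<bar>X \<omega>\<bar>) \<le> dist1 (Y n) X" for n
    unfolding dist1_def by (intro qnorm_mono e2ennreal_abs_abs_le)
  have "(\<lambda>n. dist1 (\<lambda>\<omega>. \<bar>Y n \<omega>\<bar>) (\<lambda>\<omega>. \<bar>X \<omega>\<bar>)) \<longlonglongrightarrow> 0"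
    by (rule tendsto_sandwich[OF _ _ tendsto_const lim]) (auto simp: le)
  then show *: "L1_approx (\<lambda>n \<omega>. \<bar>Y n \<omega>\<bar>) (\<lambda>\<omega>. \<bar>X \<omega>\<bar>)"
    by (intro L1_approxI H_abs YH) auto
  obtain n where "dist1 (Y n) X < 1"
    using order_tendstoD(2)[OF lim, of 1] by (auto simp: eventually_sequentially)
  then have "dist1 (Y n) X + ennreal (expect (\<lambda>\<omega>. \<bar>Y n \<omega>\<bar>)) < \<top>"
    by (auto simp: ennreal_add_eq_top less_top[symmetric])
  then have "(\<lambda>\<omega>. \<bar>X \<omega>\<bar>) \<in> H_ext"
    using qnorm_abs_le_dist1[OF YH, of X n] by (intro H_extI) (auto intro: le_less_trans)
  then show "(\<lambda>\<omega>. \<bar>X \<omega>\<bar>) \<in> L1"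
    using * by (auto simp: L1_def)
qed

text \<open>\<open>Y\<close> need not be \<open>F t\<close>-measurable, so \<open>X\<close> itself
  is rounded to a finite grid. Rounding costs at most \<open>e / 2\<close>. Beyond the grid
  \<open>S\<close> is 0 and the error \<open>\<bar>X\<bar>\<close> is at most
  \<open>\<bar>Y - X\<bar> + \<bar>Y\<bar>\<close>; the last term lies in \<open>H\<close>, where
  continuity from above makes its part on \<open>B m\<close> small.\<close>

lemma simple_approx:
  assumes X: "X \<in> borel_measurable (F t)" and Y: "Y \<in> H" and e: "0 < e"
  shows "\<exists>S\<in>H_at t. dist1 S X \<le> dist1 Y X + ennreal e"
proof -
  \<comment> \<open>Infinite values become 0; this does no harm, as \<open>Y\<close> is at infinite
    distance from \<open>X\<close> there.\<close>
  define x where "x \<omega> = real_of_ereal (X \<omega>)" for \<omega>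
  have xF [measurable]: "x \<in> borel_measurable (F t)"
    unfolding x_def[abs_def] using X by measurable
  have xM [measurable]: "x \<in> borel_measurable M"
    by (rule borel_F_le_M[OF xF])
  note XM = borel_F_le_M[OF X]
  define B where "B m = {\<omega>\<in>space M. real m < \<bar>x \<omega>\<bar>}" for m :: nat
  have BM: "B m \<in> sets M" for m
    unfolding B_def by measurable
  have "(\<lambda>m. expect (\<lambda>\<omega>. \<bar>Y \<omega>\<bar> * indicator (B m) \<omega>)) \<longlonglongrightarrow> 0"
  proof (rule expect_indicator_LIMSEQ_0)
    show "decseq B"
      by (auto simp: B_def decseq_def)
    show "(\<Inter>m. B m) = {}"
    proof (safe)
      fix \<omega> assume *: "\<omega> \<in> (\<Inter>m. B m)"
      obtain m where "\<bar>x \<omega>\<bar> \<le> real m"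
        using real_arch_simple by blast
      moreover have "real m < \<bar>x \<omega>\<bar>"
        using * by (auto simp: B_def)
      ultimately show "\<omega> \<in> {}" by simp
    qed
  qed (auto intro!: H_abs Y BM)
  then obtain m where m: "expect (\<lambda>\<omega>. \<bar>Y \<omega>\<bar> * indicator (B m) \<omega>) < e / 2"
    using order_tendstoD(2)[of _ 0 sequentially "e / 2"] e by (force simp: eventually_sequentially)
  obtain k :: nat where k: "0 < k" "1 / real k < e / 2"
    using reals_Archimedean[of "e / 2"] e by (metis half_gt_zero inverse_eq_divide zero_less_Suc)
  \<comment> \<open>With mesh \<open>1 / k\<close>, an index outside the range from
    \<open>-K\<close> to \<open>K\<close> forces \<open>\<bar>x\<bar> > m\<close>, so the point lies
    in \<open>B m\<close>.\<close>
  define K where "K = int (m * k)"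
  define A where "A i = {\<omega>\<in>space M. \<lfloor>real k * x \<omega>\<rfloor> = i}" for i
  have AF: "A i \<in> sets (F t)" for i
  proof -
    have "{\<omega>\<in>space (F t). \<lfloor>real k * x \<omega>\<rfloor> = i} \<in> sets (F t)" by measurable
    then show ?thesis by (simp add: A_def space_F)
  qed
  define S where "S \<omega> = (\<Sum>i\<in>{-K..K}. of_int i / real k * indicator (A i) \<omega>)" for \<omega>
  have SH: "S \<in> H_at t"
    unfolding S_def[abs_def] H_at_def
    by (intro IntI H_sum H_scale H_ind F_le_M[OF AF] AF borel_measurable_sum borel_measurable_times
        borel_measurable_const borel_measurable_indicator) auto
  have S_eq: "S \<omega> = (if \<lfloor>real k * x \<omega>\<rfloor> \<in> {-K..K} then of_int \<lfloor>real k * x \<omega>\<rfloor> / real k else 0)"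
    if "\<omega> \<in> space M" for \<omega>
  proof -
    have "S \<omega> = (\<Sum>i\<in>{-K..K}. if \<lfloor>real k * x \<omega>\<rfloor> = i then of_int i / real k else 0)"
      unfolding S_def using that by (intro sum.cong refl) (auto simp: A_def)
    then show ?thesis by simp
  qed
  have le: "e2ennreal \<bar>ereal (S \<omega>) - X \<omega>\<bar>
      \<le> e2ennreal \<bar>ereal (Y \<omega>) - X \<omega>\<bar> + (ennreal (e / 2) + ennreal (\<bar>Y \<omega>\<bar> * indicator (B m) \<omega>))"
    if w: "\<omega> \<in> space M" for \<omega>
  proof (cases "X \<omega>")
    case (real r)
    then have xr: "x \<omega> = r" by (simp add: x_def)
    have "\<bar>S \<omega> - r\<bar> \<le> \<bar>Y \<omega> - r\<bar> + (e / 2 + \<bar>Y \<omega>\<bar> * indicator (B m) \<omega>)"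
    proof (cases "\<lfloor>real k * r\<rfloor> \<in> {-K..K}")
      case True
      have "\<bar>of_int \<lfloor>real k * r\<rfloor> - real k * r\<bar> \<le> 1" by linarith
      then have "\<bar>of_int \<lfloor>real k * r\<rfloor> - real k * r\<bar> / real k \<le> 1 / real k"
        by (intro divide_right_mono) auto
      moreover have "of_int \<lfloor>real k * r\<rfloor> / real k - r = (of_int \<lfloor>real k * r\<rfloor> - real k * r) / real k"
        using k(1) by (simp add: diff_divide_distrib)
      ultimately have "\<bar>of_int \<lfloor>real k * r\<rfloor> / real k - r\<bar> \<le> 1 / real k"
        by (simp only: abs_divide abs_of_nat)
      then have "\<bar>S \<omega> - r\<bar> \<le> e / 2"
        using S_eq[OF w] True xr k(2) by simp
      moreover have "0 \<le> \<bar>Y \<omega>\<bar> * indicator (B m) \<omega>" by simp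
      ultimately show ?thesis by linarith
    next
      case False
      then have "real k * r < - of_int K \<or> of_int K < real k * r"
        unfolding atLeastAtMost_iff by linarith
      moreover have "of_int K = real k * real m"
        by (simp add: K_def)
      ultimately have "real k * real m < \<bar>real k * r\<bar>"
        by linarith
      then have "real k * real m < real k * \<bar>r\<bar>"
        by (simp add: abs_mult)
      then have "\<omega> \<in> B m"
        using w xr k(1) by (simp add: B_def)
      moreover have "S \<omega> = 0"
        using S_eq[OF w, unfolded xr] False by (simp only: if_False)
      moreover have "\<bar>0 - r\<bar> \<le> \<bar>Y \<omega> - r\<bar> + (e / 2 + \<bar>Y \<omega>\<bar>)"
        using e by linarith
      ultimately show ?thesis
        by simp
    qed
    then have "ennreal \<bar>S \<omega> - r\<bar> \<le> ennreal (\<bar>Y \<omega> - r\<bar> + (e / 2 + \<bar>Y \<omega>\<bar> * indicator (B m) \<omega>))"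
      by (rule ennreal_leI)
    also have "\<dots> = ennreal \<bar>Y \<omega> - r\<bar> + (ennreal (e / 2) + ennreal (\<bar>Y \<omega>\<bar> * indicator (B m) \<omega>))"
      using e by (subst ennreal_plus; simp)+
    finally show ?thesis
      by (simp add: real)
  qed auto
  have IH: "(\<lambda>\<omega>. \<bar>Y \<omega>\<bar> * indicator (B m) \<omega>) \<in> H"
    by (intro H_mult_indicator H_abs Y BM)
  have [measurable]: "(\<lambda>\<omega>. \<bar>Y \<omega>\<bar> * indicator (B m) \<omega>) \<in> borel_measurable M"
    by (rule H_borel[OF IH])
  have "dist1 S X \<le> qnorm (\<lambda>\<omega>. e2ennreal \<bar>ereal (Y \<omega>) - X \<omega>\<bar>
      + (ennreal (e / 2) + ennreal (\<bar>Y \<omega>\<bar> * indicator (B m) \<omega>)))"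
    unfolding dist1_def by (intro qnorm_mono le)
  also have "\<dots> \<le> dist1 Y X + qnorm (\<lambda>\<omega>. ennreal (e / 2) + ennreal (\<bar>Y \<omega>\<bar> * indicator (B m) \<omega>))"
    unfolding dist1_def by (rule qnorm_add[OF dist_borel[OF H_borel[OF Y] XM]]) measurable
  also have "qnorm (\<lambda>\<omega>. ennreal (e / 2) + ennreal (\<bar>Y \<omega>\<bar> * indicator (B m) \<omega>))
      \<le> qnorm (\<lambda>_. ennreal (e / 2)) + qnorm (\<lambda>\<omega>. ennreal (\<bar>Y \<omega>\<bar> * indicator (B m) \<omega>))"
    by (rule qnorm_add) measurable
  also have "\<dots> = ennreal (e / 2) + ennreal (expect (\<lambda>\<omega>. \<bar>Y \<omega>\<bar> * indicator (B m) \<omega>))"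
    by (simp add: qnorm_const ennreal_expect[OF IH])
  also have "\<dots> \<le> ennreal (e / 2) + ennreal (e / 2)"
    using m by (intro add_left_mono ennreal_leI) simp
  also have "\<dots> = ennreal e"
    using e by (simp flip: ennreal_plus)
  finally show ?thesis
    using SH by (auto simp: add_left_mono)
qed

text \<open>Each member of an arbitrary approximating sequence is replaced by an
  \<open>F t\<close>-measurable one at additional cost \<open>1 / (n + 1)\<close>.\<close>

lemma L1_approx_H_at:
  assumes XL: "X \<in> L1" and XF: "X \<in> borel_measurable (F t)"
  shows "\<exists>Y. (\<forall>n. Y n \<in> H_at t) \<and> L1_approx Y X"
proof -
  obtain Y where Y: "L1_approx Y X"
    using L1D(3)[OF XL] by blast
  have "\<exists>S\<in>H_at t. dist1 S X \<le> dist1 (Y n) X + ennreal (inverse (real (Suc n)))" for n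
    by (rule simple_approx[OF XF L1_approxD(1)[OF Y]]) simp
  then obtain S where S: "\<And>n. S n \<in> H_at t"
      "\<And>n. dist1 (S n) X \<le> dist1 (Y n) X + ennreal (inverse (real (Suc n)))"
    by metis
  have "(\<lambda>n. dist1 (Y n) X + ennreal (inverse (real (Suc n)))) \<longlonglongrightarrow> 0 + ennreal 0"
    by (intro tendsto_add tendsto_ennrealI L1_approxD(2)[OF Y] LIMSEQ_inverse_real_of_nat)
  then have lim: "(\<lambda>n. dist1 (Y n) X + ennreal (inverse (real (Suc n)))) \<longlonglongrightarrow> 0"
    by simp
  have "(\<lambda>n. dist1 (S n) X) \<longlonglongrightarrow> 0"
    by (rule tendsto_sandwich[OF _ _ tendsto_const lim]) (use S(2) in \<open>auto simp del: of_nat_Suc\<close>)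
  then have "L1_approx S X"
    by (rule L1_approxI[OF H_atD(1)[OF S(1)] L1D(1)[OF XL]])
  then show ?thesis
    using S(1) by (intro exI[of _ S]) simp
qed

text \<open>At time 0 everything is constant, so convergence in the seminorm is convergence of the
  numbers \<open>expect \<bar>Y n\<bar>\<close> to \<open>expect_L1 \<bar>X\<bar>\<close>. The slack
  1 absorbs the remaining distance.\<close>

lemma expect_abs_eventually_le:
  assumes X: "X \<in> L1" and Y: "L1_approx Y X" and K: "expect_L1 (\<lambda>\<omega>. \<bar>X \<omega>\<bar>) \<le> ereal K"
  shows "\<forall>\<^sub>F n in sequentially. expect (\<lambda>\<omega>. \<bar>Y n \<omega>\<bar>) \<le> K + 1"
proof -
  define Z where "Z = E_L1 0 (\<lambda>\<omega>. \<bar>X \<omega>\<bar>)"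
  define c where "c = expect_L1 (\<lambda>\<omega>. \<bar>X \<omega>\<bar>)"
  have ZF: "Z \<in> borel_measurable (F 0)"
    using E_L1_spec(1)[OF L1_approx_abs(1)[OF X Y], of 0] by (simp add: Z_def)
  have Zc: "Z \<omega> = c" if "\<omega> \<in> space M" for \<omega>
    using F_0_const[OF ZF that] by (simp add: c_def expect_L1_def Z_def)
  have "dist1 (E 0 (\<lambda>\<omega>. \<bar>Y n \<omega>\<bar>)) Z = e2ennreal \<bar>ereal (expect (\<lambda>\<omega>. \<bar>Y n \<omega>\<bar>)) - c\<bar>" for n
  proof -
    have "dist1 (E 0 (\<lambda>\<omega>. \<bar>Y n \<omega>\<bar>)) Z
        = qnorm (\<lambda>_. e2ennreal \<bar>ereal (expect (\<lambda>\<omega>. \<bar>Y n \<omega>\<bar>)) - c\<bar>)"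
      unfolding dist1_def
      by (intro antisym qnorm_mono) (simp_all add: Zc expect_eq H_abs L1_approxD(1)[OF Y])
    then show ?thesis by (simp add: qnorm_const)
  qed
  moreover have "(\<lambda>n. dist1 (E 0 (\<lambda>\<omega>. \<bar>Y n \<omega>\<bar>)) Z) \<longlonglongrightarrow> 0"
    unfolding Z_def by (intro E_L1_spec(2) L1_approx_abs[OF X Y])
  ultimately have "(\<lambda>n. e2ennreal \<bar>ereal (expect (\<lambda>\<omega>. \<bar>Y n \<omega>\<bar>)) - c\<bar>) \<longlonglongrightarrow> 0"
    by simp
  then have "\<forall>\<^sub>F n in sequentially. e2ennreal \<bar>ereal (expect (\<lambda>\<omega>. \<bar>Y n \<omega>\<bar>)) - c\<bar> < 1"
    by (rule order_tendstoD) simp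
  then show ?thesis
  proof eventually_elim
    case (elim n)
    then show ?case
      using K unfolding c_def[symmetric]
      by (cases c) (auto simp: ennreal_less_one_iff)
  qed
qed

end

subsection \<open>Convergence\<close>

text \<open>As \<open>s n\<close> is real, subtracting \<open>s n - x n\<close> from it gives back
  \<open>x n\<close> even at infinite values; the limit \<open>l\<close> may be infinite
  too.\<close>

lemma tendsto_ereal_perturb:
  fixes x :: "nat \<Rightarrow> ereal" and s :: "nat \<Rightarrow> real"
  assumes s: "(\<lambda>n. ereal (s n)) \<longlonglongrightarrow> l" and d: "(\<lambda>n. e2ennreal \<bar>ereal (s n) - x n\<bar>) \<longlonglongrightarrow> 0"
  shows "x \<longlonglongrightarrow> l"
proof -
  define D where "D n = ereal (s n) - x n" for n
  have "(\<lambda>n. enn2ereal (e2ennreal \<bar>D n\<bar>)) \<longlonglongrightarrow> enn2ereal 0"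
    using d by (simp add: D_def)
  then have D: "(\<lambda>n. \<bar>D n\<bar>) \<longlonglongrightarrow> 0"
    by (simp add: enn2ereal_e2ennreal zero_ennreal.rep_eq)
  have "D \<longlonglongrightarrow> 0"
  proof (rule tendsto_sandwich[OF _ _ _ D])
    show "(\<lambda>n. - \<bar>D n\<bar>) \<longlonglongrightarrow> 0"
      using tendsto_uminus_ereal[OF D] by simp
    have "- \<bar>y\<bar> \<le> y \<and> y \<le> \<bar>y\<bar>" for y :: ereal
      by (cases y) auto
    then show "\<forall>\<^sub>F n in sequentially. - \<bar>D n\<bar> \<le> D n" "\<forall>\<^sub>F n in sequentially. D n \<le> \<bar>D n\<bar>"
      by auto
  qed
  then have "(\<lambda>n. ereal (s n) - D n) \<longlonglongrightarrow> l - 0"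
    by (intro tendsto_diff_ereal_general s) auto
  moreover have "ereal (s n) - D n = x n" for n
    by (cases "x n") (auto simp: D_def)
  ultimately show ?thesis by simp
qed

text \<open>Rational levels reduce non-convergence to countably many oscillation events.\<close>

lemma liminf_less_limsup_oscillates:
  fixes s :: "nat \<Rightarrow> real"
  assumes "liminf (\<lambda>n. ereal (s n)) < limsup (\<lambda>n. ereal (s n))"
  obtains a b :: rat where "a < b" "\<forall>m. \<exists>t\<ge>m. s t \<le> of_rat a" "\<forall>m. \<exists>t\<ge>m. of_rat b \<le> s t"
proof -
  obtain b :: rat where b: "liminf (\<lambda>n. ereal (s n)) < ereal (of_rat b)"
      "ereal (of_rat b) < limsup (\<lambda>n. ereal (s n))"
    using ereal_dense3[OF assms] by auto
  obtain a :: rat where a: "liminf (\<lambda>n. ereal (s n)) < ereal (of_rat a)" "ereal (of_rat a) < ereal (of_rat b)"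
    using ereal_dense3[OF b(1)] by auto
  have "\<exists>t\<ge>m. s t \<le> of_rat a" for m
  proof (rule ccontr)
    assume "\<not> ?thesis"
    then have "\<forall>\<^sub>F t in sequentially. ereal (of_rat a) \<le> ereal (s t)"
      by (intro eventually_sequentiallyI[of m]) (metis ereal_less_eq(3) linorder_le_cases)
    then have "ereal (of_rat a) \<le> liminf (\<lambda>n. ereal (s n))"
      by (rule Liminf_bounded)
    then show False using a(1) by simp
  qed
  moreover have "\<exists>t\<ge>m. of_rat b \<le> s t" for m
  proof (rule ccontr)
    assume "\<not> ?thesis"
    then have "\<forall>\<^sub>F t in sequentially. ereal (s t) \<le> ereal (of_rat b)"
      by (intro eventually_sequentiallyI[of m]) (metis ereal_less_eq(3) linorder_le_cases)
    then have "limsup (\<lambda>n. ereal (s n)) \<le> ereal (of_rat b)"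
      by (rule Limsup_bounded)
    then show False using b(2) by simp
  qed
  moreover have "a < b"
    using a(2) by (simp add: of_rat_less)
  ultimately show ?thesis
    using that by blast
qed

text \<open>If the real numbers \<open>s\<close> and \<open>e\<close> approximate
  \<open>x \<le> y\<close>, then \<open>s\<close> can exceed \<open>e\<close> only by the two
  approximation errors.\<close>

lemma ennreal_max_diff_le:
  fixes x y :: ereal
  assumes "x \<le> y"
  shows "ennreal (max 0 (s - e)) \<le> e2ennreal \<bar>ereal s - x\<bar> + e2ennreal \<bar>ereal e - y\<bar>"
  using assms
  by (cases x; cases y) (auto simp flip: ennreal_plus intro!: ennreal_leI)

section \<open>Reduction to an approximate submartingale in \<open>H\<close>\<close>

context sl_representation
begin

text \<open>\<open>S t\<close> is taken so far along an approximating sequence of \<open>X t\<close>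
  that it, its absolute expectation and its conditional expectation one step earlier are all under
  control. The submartingale inequality then fails for \<open>S\<close> by at most the errors at
  \<open>t\<close> and \<open>t + 1\<close>.\<close>

lemma H_approx_submartingale:
  assumes sub: "sl_submartingale X" and K: "\<And>k. expect_L1 (\<lambda>\<omega>. \<bar>X k \<omega>\<bar>) \<le> ereal K"
  obtains S where "\<And>t. S t \<in> H_at t" "\<And>t. dist1 (S t) (X t) \<le> ennreal ((1/2)^t)"
    "\<And>t. expect (\<lambda>\<omega>. \<bar>S t \<omega>\<bar>) \<le> K + 1"
    "\<And>t. expect (\<lambda>\<omega>. max 0 (S t \<omega> - E t (S (Suc t)) \<omega>)) \<le> 2 * (1/2)^t"
proof -
  have XL: "X t \<in> L1" and XF: "X t \<in> borel_measurable (F t)"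
    and XE: "s \<le> t \<Longrightarrow> quasi_surely (\<lambda>\<omega>. X s \<omega> \<le> E_L1 s (X t) \<omega>)" for s t
    using sub by (auto simp: sl_submartingale_def)
  \<comment> \<open>The condition at \<open>t - 1\<close> is used later with \<open>Suc t\<close> in
    place of \<open>t\<close>; for \<open>t = 0\<close> the truncated difference is 0 and the
    condition can still be met.\<close>
  have "\<exists>S\<in>H_at t. dist1 S (X t) \<le> ennreal ((1/2)^t) \<and> expect (\<lambda>\<omega>. \<bar>S \<omega>\<bar>) \<le> K + 1 \<and>
      dist1 (E (t - 1) S) (E_L1 (t - 1) (X t)) \<le> ennreal ((1/2)^t)" for t
  proof -
    obtain Y where Y: "\<And>n. Y n \<in> H_at t" "L1_approx Y (X t)"
      using L1_approx_H_at[OF XL XF] by blast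
    have pos: "0 < ennreal ((1/2)^t)" by simp
    have "\<forall>\<^sub>F n in sequentially. dist1 (Y n) (X t) < ennreal ((1/2)^t)"
      by (rule order_tendstoD(2)[OF L1_approxD(2)[OF Y(2)] pos])
    moreover have "\<forall>\<^sub>F n in sequentially. expect (\<lambda>\<omega>. \<bar>Y n \<omega>\<bar>) \<le> K + 1"
      by (rule expect_abs_eventually_le[OF XL Y(2) K])
    moreover have "\<forall>\<^sub>F n in sequentially. dist1 (E (t - 1) (Y n)) (E_L1 (t - 1) (X t)) < ennreal ((1/2)^t)"
      by (rule order_tendstoD(2)[OF E_L1_spec(2)[OF XL Y(2)] pos])
    ultimately have "\<forall>\<^sub>F n in sequentially. dist1 (Y n) (X t) \<le> ennreal ((1/2)^t) \<and>
        expect (\<lambda>\<omega>. \<bar>Y n \<omega>\<bar>) \<le> K + 1 \<and>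
        dist1 (E (t - 1) (Y n)) (E_L1 (t - 1) (X t)) \<le> ennreal ((1/2)^t)"
      by eventually_elim (blast intro: less_imp_le)
    then show ?thesis
      using Y(1) by (auto simp: eventually_sequentially)
  qed
  then obtain S where S: "\<And>t. S t \<in> H_at t" "\<And>t. dist1 (S t) (X t) \<le> ennreal ((1/2)^t)"
    "\<And>t. expect (\<lambda>\<omega>. \<bar>S t \<omega>\<bar>) \<le> K + 1"
    "\<And>t. dist1 (E (t - 1) (S t)) (E_L1 (t - 1) (X t)) \<le> ennreal ((1/2)^t)"
    by metis
  note SH = H_atD(1)[OF S(1)]
  have "expect (\<lambda>\<omega>. max 0 (S t \<omega> - E t (S (Suc t)) \<omega>)) \<le> 2 * (1/2)^t" for t
  proof -
    define Z where "Z = E_L1 t (X (Suc t))"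
    have ZM: "Z \<in> borel_measurable M"
      using E_L1_spec(1)[OF XL, of t] borel_F_le_M by (auto simp: Z_def)
    have "ennreal (expect (\<lambda>\<omega>. max 0 (S t \<omega> - E t (S (Suc t)) \<omega>)))
        = qnorm (\<lambda>\<omega>. ennreal (max 0 (S t \<omega> - E t (S (Suc t)) \<omega>)))"
      by (intro ennreal_expect H_max0 H_diff SH E_in_H) simp
    also have "\<dots> \<le> qnorm (\<lambda>\<omega>. e2ennreal \<bar>ereal (S t \<omega>) - X t \<omega>\<bar> + e2ennreal \<bar>ereal (E t (S (Suc t)) \<omega>) - Z \<omega>\<bar>)"
    proof (rule qnorm_mono_AE)
      fix \<theta> assume "\<theta> \<in> \<Theta>"
      moreover have "quasi_surely (\<lambda>\<omega>. X t \<omega> \<le> Z \<omega>)"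
        unfolding Z_def by (rule XE) simp
      ultimately have "AE \<omega> in \<theta>. X t \<omega> \<le> Z \<omega>"
        by (intro quasi_surely_AE)
      then
      show "AE \<omega> in \<theta>. ennreal (max 0 (S t \<omega> - E t (S (Suc t)) \<omega>))
          \<le> e2ennreal \<bar>ereal (S t \<omega>) - X t \<omega>\<bar> + e2ennreal \<bar>ereal (E t (S (Suc t)) \<omega>) - Z \<omega>\<bar>"
        by eventually_elim (rule ennreal_max_diff_le)
    qed
    also have "\<dots> \<le> dist1 (S t) (X t) + dist1 (E t (S (Suc t))) Z"
      unfolding dist1_def by (intro qnorm_add dist_borel H_borel SH E_in_H ZM L1D(1)[OF XL])
    also have "\<dots> \<le> ennreal ((1/2)^t) + ennreal ((1/2)^Suc t)"
      using S(2)[of t] S(4)[of "Suc t"] by (intro add_mono) (simp_all add: Z_def)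
    also have "\<dots> = ennreal ((1/2)^t + (1/2)^Suc t)"
      by (rule ennreal_plus[symmetric]) auto
    also have "\<dots> \<le> ennreal (2 * (1/2)^t)"
      by (intro ennreal_leI) simp
    finally show ?thesis
      by (simp add: ennreal_le_iff)
  qed
  then show ?thesis
    using that S by blast
qed

lemma submartingale_convergence:
  assumes sub: "sl_submartingale X" and bnd: "(SUP k. expect_L1 (\<lambda>\<omega>. \<bar>X k \<omega>\<bar>)) < \<infinity>"
  shows "\<exists>X_inf. X_inf \<in> H_ext \<and> expect_ext (\<lambda>\<omega>. \<bar>X_inf \<omega>\<bar>) < \<infinity> \<and>
    quasi_surely (\<lambda>\<omega>. (\<lambda>n. X n \<omega>) \<longlonglongrightarrow> X_inf \<omega>)"
proof -
  obtain K where "(SUP k. expect_L1 (\<lambda>\<omega>. \<bar>X k \<omega>\<bar>)) < ereal K"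
    using ereal_dense2[OF bnd] by auto
  then have K: "expect_L1 (\<lambda>\<omega>. \<bar>X k \<omega>\<bar>) \<le> ereal K" for k
    by (meson SUP_upper UNIV_I less_imp_le order_trans)
  obtain S where S: "\<And>t. S t \<in> H_at t" "\<And>t. dist1 (S t) (X t) \<le> ennreal ((1/2)^t)"
    "\<And>t. expect (\<lambda>\<omega>. \<bar>S t \<omega>\<bar>) \<le> K + 1"
    "\<And>t. expect (\<lambda>\<omega>. max 0 (S t \<omega> - E t (S (Suc t)) \<omega>)) \<le> 2 * (1/2)^t"
    using H_approx_submartingale[OF sub K] by blast
  note SH = H_atD(1)[OF S(1)]
  have XM [measurable]: "X t \<in> borel_measurable M" for t
    using sub by (auto simp: sl_submartingale_def intro: L1D(1))
  \<comment> \<open>The exact deficit in the one-step submartingale inequality for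
    \<open>S\<close>.\<close>
  define z where "z t \<omega> = max 0 (S t \<omega> - E t (S (Suc t)) \<omega>)" for t \<omega>
  have z_at: "z t \<in> H_at t" for t
    unfolding z_def[abs_def] by (intro H_at_max0 H_at_diff S(1) E_H SH)
  \<comment> \<open>4 is the sum of the geometric series with terms \<open>2 * (1/2)^i\<close>;
    starting later only makes the terms smaller.\<close>
  have z_sum: "(\<Sum>i<j. expect (z (n + i))) \<le> 4" for n j
  proof -
    have "(\<Sum>i<j. expect (z (n + i))) \<le> (\<Sum>i<j. 2 * (1/2)^i)"
    proof (rule sum_mono)
      fix i
      have "expect (z (n + i)) \<le> 2 * (1/2)^(n + i)"
        using S(4)[of "n + i"] by (simp add: z_def[abs_def])
      also have "\<dots> \<le> 2 * (1/2::real)^i"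
        by (intro mult_left_mono power_decreasing) auto
      finally show "expect (z (n + i)) \<le> 2 * (1/2)^i" .
    qed
    also have "\<dots> = 4 - 4 * (1/2)^j"
      by (induction j) auto
    finally show ?thesis
      by (smt (verit) zero_le_power divide_nonneg_nonneg)
  qed
  have osc0: "expect (indicator (osc S a b)) = 0" if "a < b" for a b
  proof (rule osc_null[OF S(1) z_at _ _ S(3) z_sum that])
    show "0 \<le> z t \<omega>" "S t \<omega> \<le> E t (S (Suc t)) \<omega> + z t \<omega>" for t \<omega>
      by (simp_all add: z_def)
  qed
  have no_osc: "AE \<omega> in \<theta>. \<forall>a b::rat. a < b \<longrightarrow> \<omega> \<notin> osc S (of_rat a) (of_rat b)" if th: "\<theta> \<in> \<Theta>" for \<theta>
    unfolding AE_all_countable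
  proof (intro allI)
    fix a b :: rat
    have "quasi_surely (\<lambda>\<omega>. a < b \<longrightarrow> \<omega> \<notin> osc S (of_rat a) (of_rat b))"
    proof (cases "a < b")
      case True
      then have "expect (indicator (osc S (of_rat a) (of_rat b))) = 0"
        by (intro osc0) (simp add: of_rat_less)
      then show ?thesis
        unfolding quasi_surely_def
        by (intro bexI[of _ "osc S (of_rat a) (of_rat b)"] osc_sets H_borel SH) auto
    next
      case False
      then show ?thesis
        unfolding quasi_surely_def
        using expect_indicator_empty by (intro bexI[of _ "{}"]) auto
    qed
    then show "AE \<omega> in \<theta>. a < b \<longrightarrow> \<omega> \<notin> osc S (of_rat a) (of_rat b)"
      by (rule quasi_surely_AE[OF _ th])
  qed
  \<comment> \<open>The limit is chosen independently of \<theta>; under each \<theta> it agrees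
    almost everywhere with the limit of \<open>S\<close>.\<close>
  define X_inf where "X_inf \<omega> = liminf (\<lambda>n. X n \<omega>)" for \<omega>
  have X_infM: "X_inf \<in> borel_measurable M"
    unfolding X_inf_def[abs_def] by measurable
  have lim: "AE \<omega> in \<theta>. (\<lambda>n. ereal (S n \<omega>)) \<longlonglongrightarrow> X_inf \<omega> \<and> (\<lambda>n. X n \<omega>) \<longlonglongrightarrow> X_inf \<omega>"
    if th: "\<theta> \<in> \<Theta>" for \<theta>
  proof -
    have "AE \<omega> in \<theta>. (\<Sum>n. e2ennreal \<bar>ereal (S n \<omega>) - X n \<omega>\<bar>) \<noteq> \<top>"
      using S(2) by (intro AE_suminf_finite dist_borel H_borel SH XM th) (simp add: dist1_def)
    with no_osc[OF th] AE_space show ?thesis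
    proof eventually_elim
      case (elim \<omega>)
      define l where "l = liminf (\<lambda>n. ereal (S n \<omega>))"
      have "\<not> l < limsup (\<lambda>n. ereal (S n \<omega>))"
      proof
        assume "l < limsup (\<lambda>n. ereal (S n \<omega>))"
        then obtain a b :: rat where ab: "a < b" "\<forall>m. \<exists>t\<ge>m. S t \<omega> \<le> of_rat a"
            "\<forall>m. \<exists>t\<ge>m. of_rat b \<le> S t \<omega>"
          unfolding l_def by (rule liminf_less_limsup_oscillates)
        then have "\<omega> \<in> osc S (of_rat a) (of_rat b)"
          using elim(2) Theta_space[OF th] by (simp add: osc_def)
        then show False
          using elim(1) ab(1) by simp
      qed
      moreover have "l \<le> limsup (\<lambda>n. ereal (S n \<omega>))"
        unfolding l_def by (rule Liminf_le_Limsup) simp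
      ultimately have Sl: "(\<lambda>n. ereal (S n \<omega>)) \<longlonglongrightarrow> l"
        by (intro Liminf_eq_Limsup) (auto simp: l_def)
      have Xl: "(\<lambda>n. X n \<omega>) \<longlonglongrightarrow> l"
        by (rule tendsto_ereal_perturb[OF Sl ennreal_suminf_LIMSEQ_0[OF elim(3)]])
      then have "X_inf \<omega> = l"
        unfolding X_inf_def by (intro lim_imp_Liminf) simp
      then show ?case using Sl Xl by simp
    qed
  qed
  \<comment> \<open>Fatou's lemma is applied along \<open>S\<close>, which is real-valued and has
    the uniform bound \<open>K + 1\<close>.\<close>
  have "qnorm (\<lambda>\<omega>. e2ennreal \<bar>X_inf \<omega>\<bar>) \<le> ennreal (K + 1)"
  proof (rule qnorm_Fatou[where W = S and m = 0])
    show "qnorm (\<lambda>\<omega>. ennreal \<bar>S j \<omega>\<bar>) \<le> ennreal (K + 1)" for j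
      using ennreal_expect[OF H_abs[OF SH]] ennreal_leI[OF S(3)] by (metis abs_ge_zero)
    show "AE \<omega> in \<theta>. (\<lambda>j. ereal (S j \<omega>)) \<longlonglongrightarrow> X_inf \<omega>" if "\<theta> \<in> \<Theta>" for \<theta>
      using lim[OF that] by auto
  qed (intro H_borel SH)
  also have "\<dots> < \<top>" by simp
  finally have fin: "qnorm (\<lambda>\<omega>. e2ennreal \<bar>X_inf \<omega>\<bar>) < \<top>" .
  have "expect_ext (\<lambda>\<omega>. \<bar>X_inf \<omega>\<bar>) < \<infinity>"
    using fin by (simp add: expect_ext_nonneg less_top[symmetric])
  moreover have "quasi_surely (\<lambda>\<omega>. (\<lambda>n. X n \<omega>) \<longlonglongrightarrow> X_inf \<omega>)"
  proof (rule quasi_surelyI)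
    \<comment> \<open>As \<open>X_inf\<close> is the lower limit, convergence is equality with the
      upper limit, which makes the convergence set measurable.\<close>
    have "(\<lambda>n. X n \<omega>) \<longlonglongrightarrow> X_inf \<omega> \<longleftrightarrow> limsup (\<lambda>n. X n \<omega>) = X_inf \<omega>" for \<omega>
      using lim_imp_Limsup[of sequentially "\<lambda>n. X n \<omega>" "X_inf \<omega>"]
        Liminf_eq_Limsup[of sequentially "\<lambda>n. X n \<omega>" "X_inf \<omega>"] by (auto simp: X_inf_def)
    then show "{\<omega>\<in>space M. (\<lambda>n. X n \<omega>) \<longlonglongrightarrow> X_inf \<omega>} \<in> sets M"
      using X_infM by simp
  qed (use lim in auto)
  ultimately show ?thesis
    using H_extI[OF X_infM fin] by blast
qed

end

theorem theorem4p4: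
  fixes M :: "'a measure" and F :: "nat \<Rightarrow> 'a measure" and H :: "('a \<Rightarrow> real) set"
    and E :: "nat \<Rightarrow> ('a \<Rightarrow> real) \<Rightarrow> 'a \<Rightarrow> real" and \<Theta> :: "'a measure set"
    and X :: "nat \<Rightarrow> 'a \<Rightarrow> ereal"
  assumes "sl_representation M F H E \<Theta>"
    and "sl_representation.sl_submartingale M F H E \<Theta> X"
    and "(SUP k. sl_representation.expect_L1 M F H E \<Theta> (\<lambda>\<omega>. \<bar>X k \<omega>\<bar>)) < \<infinity>"
  shows "\<exists>X_inf. X_inf \<in> sl_representation.H_ext M \<Theta> \<and>
    sl_representation.expect_ext \<Theta> (\<lambda>\<omega>. \<bar>X_inf \<omega>\<bar>) < \<infinity> \<and>
    sl_expectation.quasi_surely M E (\<lambda>\<omega>. (\<lambda>n. X n \<omega>) \<longlonglongrightarrow> X_inf \<omega>)"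
  using assms by (rule sl_representation.submartingale_convergence)

end
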